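(* For every constant $c>1$ there exists a constant $C>0$ such that for all integers $n\ge1$, $m\ge1$, every sufficiently large $H$ (depending on $c$ and $m$), every succinct sub-additive valuation function profile $v=(v_i)_{i\in[n]}$, and every DSIC non-adaptive query mechanism $\mathcal M$ making (in expectation) fewer than $C\,nm\log_c H$ value and quantile queries, there exists a multi-item Bayesian auction instance $\mathcal I=(N,M,\mathcal D)$ with valuation profile $v$, $|N|=n$, $|M|=m$ and all item-value distributions $\mathcal D_{ij}$ supported in $[1,H]$, such that $Rev(\mathcal M(\mathcal I))<OPT(\mathcal I)/c$.
   Context: A Bayesian auction instance $\mathcal I=(N,M,\mathcal D)$ has players $N=\{1,\dots,n\}$, items $M=\{1,\dots,m\}$ and a product prior $\mathcal D=\times_{i\in N,j\in M}\mathcal D_{ij}$; the item values $v_{ij}$ are drawn independently from $\mathcal D_{ij}$. A succinct sub-additive valuation function for player $i$ is a publicly known function $v_i$ that takes a vector of item values $(v_{ij})_{j\in[m]}$ and a subset $S\subseteq[m]$ and returns $i$'s value for $S$, such that for every item-value vector $x$, the set function $S\mapsto v_i(x,S)$ is monotone and sub-additive ($v_i(x,S)+v_i(x,T)\ge v_i(x,S\cup T)\ge v_i(x,S)\ge0$) and $v_i(x,\{j\})=x_j$ for each item $j$. Single-item, unit-demand and additive valuations are special cases. $OPT(\mathcal I)$ denotes the optimal expected revenue over all BIC, individually rational mechanisms for $\mathcal I$. A mechanism is DSIC if truthful reporting is a dominant strategy (and it is individually rational). Oracle queries to a distribution $D$: a value query $v$ is answered by $q(v)=\Pr_{x\sim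 D}[x\ge v]$; a quantile query $q\in[0,1]$ is answered by $v(q)=\max\{z:\Pr_{x\sim D}[x\ge z]\ge q\}$. A non-adaptive query mechanism first selects (possibly at random) a finite list of queries, each addressed to some $\mathcal D_{ij}$, receives all answers at once, and then runs a (possibly randomized) mechanism on the reported values that may depend on the answers but has no other access to $\mathcal D$; it is DSIC if the mechanism it runs is DSIC for every realization of the answers. $Rev(\mathcal M(\mathcal I))$ is its expected revenue when values are drawn from $\mathcal D$. *)

theory Defs
  imports "HOL-Probability.Probability"
begin

text \<open>Players are 0..n-1, items are 0..m-1 (natural numbers).
  A (reported or true) value profile assigns to (player i, item j) the value b (i,j).\<close>

type_synonym profile = "nat \<times> nat \<Rightarrow> real"

text \<open>An allocation maps every item to its winner (None = unallocated).\<close>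
type_synonym alloc = "nat \<Rightarrow> nat option"

text \<open>A (possibly randomized) mechanism: for each reported profile a lottery over
  allocations, and the (expected) payment of each player.\<close>
type_synonym mech = "(profile \<Rightarrow> alloc pmf) \<times> (profile \<Rightarrow> nat \<Rightarrow> real)"

text \<open>Succinct valuation profile: v i x S is player i's value for bundle S
  when its item-value vector is x.\<close>
type_synonym valuation = "nat \<Rightarrow> (nat \<Rightarrow> real) \<Rightarrow> nat set \<Rightarrow> real"

definition succinct_subadditive :: "nat \<Rightarrow> nat \<Rightarrow> valuation \<Rightarrow> bool" where
  "succinct_subadditive n m v \<longleftrightarrow>
     (\<forall>i<n. \<forall>x::nat \<Rightarrow> real. (\<forall>j<m. 0 \<le> x j) \<longrightarrow>
        (\<forall>S T. S \<subseteq> {..<m} \<longrightarrow> T \<subseteq> {..<m} \<longrightarrow>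
            v i x (S \<union> T) \<le> v i x S + v i x T \<and> v i x S \<le> v i x (S \<union> T) \<and> 0 \<le> v i x S) \<and>
        (\<forall>j<m. v i x {j} = x j))"

definition restrict_items :: "nat \<Rightarrow> (nat \<Rightarrow> real) \<Rightarrow> nat \<Rightarrow> real" where
  "restrict_items m t = (\<lambda>j. if j < m then t j else 0)"

definition player_vec :: "nat \<Rightarrow> profile \<Rightarrow> nat \<Rightarrow> nat \<Rightarrow> real" where
  "player_vec m b i = restrict_items m (\<lambda>j. b (i, j))"

definition replace_report :: "profile \<Rightarrow> nat \<Rightarrow> (nat \<Rightarrow> real) \<Rightarrow> profile" where
  "replace_report b i t = (\<lambda>(k, j). if k = i then t j else b (k, j))"

definition bundle_of :: "nat \<Rightarrow> nat \<Rightarrow> alloc \<Rightarrow> nat set" where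
  "bundle_of m i a = {j. j < m \<and> a j = Some i}"

definition feasible_alloc :: "nat \<Rightarrow> nat \<Rightarrow> alloc \<Rightarrow> bool" where
  "feasible_alloc n m a \<longleftrightarrow>
     (\<forall>j. (j < m \<longrightarrow> (case a j of None \<Rightarrow> True | Some i \<Rightarrow> i < n)) \<and> (m \<le> j \<longrightarrow> a j = None))"

definition feasible_mech :: "nat \<Rightarrow> nat \<Rightarrow> mech \<Rightarrow> bool" where
  "feasible_mech n m M \<longleftrightarrow> (\<forall>b. \<forall>a \<in> set_pmf (fst M b). feasible_alloc n m a)"

definition utility :: "nat \<Rightarrow> valuation \<Rightarrow> mech \<Rightarrow> nat \<Rightarrow> (nat \<Rightarrow> real) \<Rightarrow> profile \<Rightarrow> real" where
  "utility m v M i t b =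
     measure_pmf.expectation (fst M b) (\<lambda>a. v i (restrict_items m t) (bundle_of m i a)) - snd M b i"

definition nonneg_profile :: "nat \<Rightarrow> nat \<Rightarrow> profile \<Rightarrow> bool" where
  "nonneg_profile n m b \<longleftrightarrow> (\<forall>i<n. \<forall>j<m. 0 \<le> b (i, j))"

definition DSIC :: "nat \<Rightarrow> nat \<Rightarrow> valuation \<Rightarrow> mech \<Rightarrow> bool" where
  "DSIC n m v M \<longleftrightarrow> feasible_mech n m M \<and>
     (\<forall>b. nonneg_profile n m b \<longrightarrow> (\<forall>i<n.
        0 \<le> utility m v M i (player_vec m b i) b \<and>
        (\<forall>t. (\<forall>j<m. 0 \<le> t j) \<longrightarrow>
           utility m v M i (player_vec m b i) (replace_report b i t)
             \<le> utility m v M i (player_vec m b i) b)))"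

definition valid_instance :: "nat \<Rightarrow> nat \<Rightarrow> real \<Rightarrow> (nat \<Rightarrow> nat \<Rightarrow> real measure) \<Rightarrow> bool" where
  "valid_instance n m H D \<longleftrightarrow>
     (\<forall>i<n. \<forall>j<m. prob_space (D i j) \<and> sets (D i j) = sets borel \<and> measure (D i j) {1..H} = 1)"

definition prior :: "nat \<Rightarrow> nat \<Rightarrow> (nat \<Rightarrow> nat \<Rightarrow> real measure) \<Rightarrow> profile measure" where
  "prior n m D = PiM ({..<n} \<times> {..<m}) (\<lambda>p. D (fst p) (snd p))"

definition supp :: "real measure \<Rightarrow> real set" where
  "supp \<mu> = {x. \<forall>e>0. 0 < measure \<mu> (ball x e)}"

definition typespace :: "nat \<Rightarrow> (nat \<Rightarrow> nat \<Rightarrow> real measure) \<Rightarrow> nat \<Rightarrow> (nat \<Rightarrow> real) set" where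
  "typespace m D i = {t. \<forall>j<m. t j \<in> supp (D i j)}"

definition BIC :: "nat \<Rightarrow> nat \<Rightarrow> valuation \<Rightarrow> (nat \<Rightarrow> nat \<Rightarrow> real measure) \<Rightarrow> mech \<Rightarrow> bool" where
  "BIC n m v D M \<longleftrightarrow> feasible_mech n m M \<and>
     (\<forall>i<n. integrable (prior n m D) (\<lambda>b. snd M b i) \<and>
        (\<forall>t \<in> typespace m D i. \<forall>t' \<in> typespace m D i.
           integrable (prior n m D) (\<lambda>b. utility m v M i t (replace_report b i t)) \<and>
           integrable (prior n m D) (\<lambda>b. utility m v M i t (replace_report b i t')) \<and>
           0 \<le> (\<integral>b. utility m v M i t (replace_report b i t) \<partial>prior n m D) \<and>
           (\<integral>b. utility m v M i t (replace_report b i t') \<partial>prior n m D)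
             \<le> (\<integral>b. utility m v M i t (replace_report b i t) \<partial>prior n m D)))"

definition Rev :: "nat \<Rightarrow> nat \<Rightarrow> (nat \<Rightarrow> nat \<Rightarrow> real measure) \<Rightarrow> mech \<Rightarrow> real" where
  "Rev n m D M = (\<integral>b. (\<Sum>i<n. snd M b i) \<partial>prior n m D)"

definition OPT :: "nat \<Rightarrow> nat \<Rightarrow> valuation \<Rightarrow> (nat \<Rightarrow> nat \<Rightarrow> real measure) \<Rightarrow> real" where
  "OPT n m v D = Sup {Rev n m D M | M. BIC n m v D M}"

datatype query = ValQ nat nat real | QuantQ nat nat real

definition answer :: "nat \<Rightarrow> nat \<Rightarrow> (nat \<Rightarrow> nat \<Rightarrow> real measure) \<Rightarrow> query \<Rightarrow> real" where
  "answer n m D q = (case q of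
      ValQ i j z \<Rightarrow> (if i < n \<and> j < m then measure (D i j) {z..} else 0)
    | QuantQ i j p \<Rightarrow> (if i < n \<and> j < m then Sup {z. p \<le> measure (D i j) {z..}} else 0))"

text \<open>A non-adaptive query mechanism: random coins r drawn from R, a query list qs r,
  and a mechanism QM r answers run on the reports.\<close>
definition query_DSIC :: "nat \<Rightarrow> nat \<Rightarrow> valuation \<Rightarrow> real measure \<Rightarrow> (real \<Rightarrow> query list)
    \<Rightarrow> (real \<Rightarrow> real list \<Rightarrow> mech) \<Rightarrow> bool" where
  "query_DSIC n m v R qs QM \<longleftrightarrow> prob_space R \<and> (\<forall>r as. DSIC n m v (QM r as))"

definition expected_queries :: "real measure \<Rightarrow> (real \<Rightarrow> query list) \<Rightarrow> ennreal" where
  "expected_queries R qs = (\<integral>\<^sup>+ r. ennreal (real (length (qs r))) \<partial>R)"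

definition QRev :: "nat \<Rightarrow> nat \<Rightarrow> (nat \<Rightarrow> nat \<Rightarrow> real measure) \<Rightarrow> real measure \<Rightarrow> (real \<Rightarrow> query list)
    \<Rightarrow> (real \<Rightarrow> real list \<Rightarrow> mech) \<Rightarrow> real" where
  "QRev n m D R qs QM = (\<integral>r. Rev n m D (QM r (map (answer n m D) (qs r))) \<partial>R)"

end

theory Submission
  imports Defs
begin

text \<open>Fix a player \<open>i\<close> and an item \<open>j\<close>, let every other item value be the constant \<open>1\<close>, and let
  \<open>w x\<close> be the amount by which item \<open>j\<close> of value \<open>x\<close> exceeds player \<open>i\<close>'s value of the empty bundle.
  Sub-additivity makes the bundle values of \<open>i\<close> agree with \<open>w x\<close> times the indicator of winning \<open>j\<close>
  up to an additive \<open>m\<close>, and the other players pay at most \<open>m\<close> altogether, so a DSIC mechanism behaves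
  like a single-item mechanism up to \<open>O(m)\<close>.

  Let \<open>x 0 < \<dots> < x K\<close> be a geometric scale. If \<open>w (x k)\<close> is much smaller than \<open>x k\<close> for some \<open>k\<close>, the
  point mass at \<open>x k\<close> is a bad instance. Otherwise give the value of \<open>(i, j)\<close> the tail
  \<open>w (x 0) / w (x k)\<close>, for which all posted prices earn the same, and hide a bump: the mass at scale \<open>\<kappa>\<close>
  is moved to scale \<open>\<kappa> + 1\<close>, which multiplies the best posted revenue by \<open>\<rho> = w (x (\<kappa> + 1)) / w (x \<kappa>)\<close>. Summation
  by parts bounds the revenue on the bumped instance by the base revenue plus \<open>\<rho> - 1\<close> times the
  increment, from \<open>x \<kappa>\<close> to \<open>x (\<kappa> + 1)\<close>, of the probability that \<open>i\<close> wins \<open>j\<close>. These increments telescope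
  over the bumps that the queries do not detect, and one query detects at most one triple
  \<open>(i, j, \<kappa>)\<close>. Averaging over the triples shows that of the order of \<open>n m K\<close> queries are needed. The
  resulting bound is affine in the number of queries, hence compatible with the integral of a possibly
  non-measurable number of queries.\<close>

section \<open>Instances with a single random item value\<close>

text \<open>The points of a product measure are extensional functions, hence the restriction to the
  index set.\<close>

definition prof :: "nat \<Rightarrow> nat \<Rightarrow> nat \<Rightarrow> nat \<Rightarrow> real \<Rightarrow> profile" where
  "prof n m i j x = (\<lambda>p\<in>{..<n} \<times> {..<m}. if p = (i, j) then x else 1)"

definition ivec :: "nat \<Rightarrow> nat \<Rightarrow> real \<Rightarrow> nat \<Rightarrow> real" where
  "ivec m j x = restrict_items m (\<lambda>l. if l = j then x else 1)"

text \<open>Mapping along the identity replaces the discrete sigma-algebra of \<open>P\<close> by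
  the Borel one, which \<open>valid_instance\<close> demands.\<close>

definition inst :: "nat \<Rightarrow> nat \<Rightarrow> real pmf \<Rightarrow> nat \<Rightarrow> nat \<Rightarrow> real measure" where
  "inst i j P = (\<lambda>k l. if k = i \<and> l = j then distr (measure_pmf P) borel (\<lambda>x. x) else return borel 1)"

abbreviation profiles :: "nat \<Rightarrow> nat \<Rightarrow> profile measure" where
  "profiles n m \<equiv> PiM ({..<n} \<times> {..<m}) (\<lambda>_. borel)"

lemma prob_space_inst: "prob_space (inst i j P k l)"
  unfolding inst_def by (auto intro!: prob_space.prob_space_distr prob_space_return measure_pmf.prob_space_axioms)

lemma sets_inst [simp]: "sets (inst i j P k l) = sets borel"
  by (simp add: inst_def)

lemma measure_inst:
  assumes "A \<in> sets borel"
  shows "measure (inst i j P k l) A =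
    (if k = i \<and> l = j then measure_pmf.prob P A else indicator A 1)"
  using assms by (simp add: inst_def measure_distr measure_return)

lemma emeasure_inst:
  assumes "A \<in> sets borel"
  shows "emeasure (inst i j P k l) A =
    (if k = i \<and> l = j then emeasure (measure_pmf P) A else indicator A 1)"
  using assms by (simp add: inst_def emeasure_distr)

lemma measurable_prof: "prof n m i j \<in> measurable (measure_pmf P) (profiles n m)"
  by (auto simp: prof_def space_PiM measurable_pmf_measure1 intro!: restrict_PiE_iff[THEN iffD2])

lemma update_in_PiE_iff:
  assumes "q \<in> I"
  shows "(\<lambda>p\<in>I. if p = q then x else y) \<in> Pi\<^sub>E I A \<longleftrightarrow> x \<in> A q \<and> (\<forall>p\<in>I - {q}. y \<in> A p)"
  using assms by (auto simp: restrict_PiE_iff Pi_iff split: if_splits)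

text \<open>A product measure is determined by its values on boxes. The preimage of a box under
  \<open>prof\<close> is its side at \<open>(i, j)\<close> if all other sides contain 1, and is
  empty otherwise; this matches the product with the point masses.\<close>

lemma prior_inst:
  assumes "i < n" "j < m"
  shows "prior n m (inst i j P) = distr (measure_pmf P) (profiles n m) (prof n m i j)"
  unfolding prior_def
proof (rule product_sigma_finite.PiM_eqI[symmetric])
  let ?I = "{..<n} \<times> {..<m}"
  show "product_sigma_finite (\<lambda>p. inst i j P (fst p) (snd p))"
    unfolding product_sigma_finite_def
    by (intro allI prob_space_imp_sigma_finite prob_space_inst)
  show "finite ?I" by simp
  show "sets (distr (measure_pmf P) (profiles n m) (prof n m i j)) =
        sets (Pi\<^sub>M ?I (\<lambda>p. inst i j P (fst p) (snd p)))"
    unfolding sets_distr by (rule sets_PiM_cong) auto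
  fix A :: "nat \<times> nat \<Rightarrow> real set"
  assume A: "\<And>p. p \<in> ?I \<Longrightarrow> A p \<in> sets (inst i j P (fst p) (snd p))"
  have pI: "(i, j) \<in> ?I" using assms by simp
  have "emeasure (distr (measure_pmf P) (profiles n m) (prof n m i j)) (Pi\<^sub>E ?I A) =
      emeasure (measure_pmf P) (prof n m i j -` Pi\<^sub>E ?I A)"
    using A by (subst emeasure_distr[OF measurable_prof]) (auto intro!: sets_PiM_I_finite)
  also have "prof n m i j -` Pi\<^sub>E ?I A = (if \<forall>p\<in>?I - {(i, j)}. 1 \<in> A p then A (i, j) else {})"
    unfolding prof_def vimage_def update_in_PiE_iff[OF pI] by auto
  also have "emeasure (measure_pmf P) \<dots> =
      emeasure (measure_pmf P) (A (i, j)) * (\<Prod>p\<in>?I - {(i, j)}. indicator (A p) 1)"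
    by (cases "\<forall>p\<in>?I - {(i, j)}. 1 \<in> A p") (simp_all add: prod_zero_iff indicator_eq_0_iff)
  also have "\<dots> = emeasure (inst i j P i j) (A (i, j)) *
      (\<Prod>p\<in>?I - {(i, j)}. emeasure (inst i j P (fst p) (snd p)) (A p))"
    using A pI by (intro arg_cong2[where f = "(*)"] prod.cong) (auto simp: emeasure_inst)
  also have "\<dots> = (\<Prod>p\<in>?I. emeasure (inst i j P (fst p) (snd p)) (A p))"
    using prod.remove[OF _ pI, of "\<lambda>p. emeasure (inst i j P (fst p) (snd p)) (A p)"] by simp
  finally show "emeasure (distr (measure_pmf P) (profiles n m) (prof n m i j)) (Pi\<^sub>E ?I A) =
      (\<Prod>p\<in>?I. emeasure (inst i j P (fst p) (snd p)) (A p))" .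
qed

lemma integral_prior_inst:
  fixes f :: "profile \<Rightarrow> real"
  assumes "i < n" "j < m" "f \<in> borel_measurable (profiles n m)"
  shows "(\<integral>b. f b \<partial>prior n m (inst i j P)) = measure_pmf.expectation P (\<lambda>x. f (prof n m i j x))"
  using assms by (simp add: prior_inst integral_distr[OF measurable_prof])

lemma sets_prior_inst:
  assumes "i < n" "j < m"
  shows "sets (prior n m (inst i j P)) = sets (profiles n m)"
  using assms by (simp add: prior_inst)

lemma borel_measurable_prior_inst:
  assumes "i < n" "j < m"
  shows "borel_measurable (prior n m (inst i j P)) = borel_measurable (profiles n m)"
  using assms by (intro measurable_cong_sets sets_prior_inst) auto

lemma prob_space_prior_inst:
  assumes "i < n" "j < m"
  shows "prob_space (prior n m (inst i j P))"
  unfolding prior_inst[OF assms]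
  by (intro prob_space.prob_space_distr measurable_prof measure_pmf.prob_space_axioms)

text \<open>DSIC says nothing about measurable payments, and the Bochner integral of a
  non-measurable function is 0. The case distinction does not depend on \<open>P\<close>, so a given
  mechanism falls into the same case on all instances of this form.\<close>

lemma Rev_inst:
  assumes "i < n" "j < m"
  shows "Rev n m (inst i j P) M =
    (if (\<lambda>b. \<Sum>k<n. snd M b k) \<in> borel_measurable (profiles n m)
     then measure_pmf.expectation P (\<lambda>x. \<Sum>k<n. snd M (prof n m i j x) k) else 0)"
proof (cases "(\<lambda>b. \<Sum>k<n. snd M b k) \<in> borel_measurable (profiles n m)")
  case True
  then show ?thesis by (simp add: Rev_def integral_prior_inst assms)
next
  case False
  then have "\<not> integrable (prior n m (inst i j P)) (\<lambda>b. \<Sum>k<n. snd M b k)"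
    using borel_measurable_prior_inst[OF assms, of P] borel_measurable_integrable by blast
  then show ?thesis using False by (simp add: Rev_def not_integrable_integral_eq)
qed

lemma valid_inst:
  assumes "set_pmf P \<subseteq> {1..H}" "1 \<le> H"
  shows "valid_instance n m H (inst i j P)"
proof -
  have "measure_pmf.prob P {1..H} = 1"
    using assms(1) by (subst measure_pmf.prob_eq_1) (auto simp: AE_measure_pmf_iff)
  then show ?thesis using assms
    by (auto simp: valid_instance_def prob_space_inst measure_inst)
qed

text \<open>A finite set of atoms is closed, so every other point has a ball of mass 0.\<close>

lemma supp_inst:
  assumes "finite (set_pmf P)"
  shows "supp (inst i j P i j) = set_pmf P"
proof (intro set_eqI iffI)
  fix x assume "x \<in> set_pmf P"
  then have "0 < measure_pmf.prob P {x}" by (simp add: measure_pmf_single pmf_positive)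
  then show "x \<in> supp (inst i j P i j)"
    using less_le_trans[OF _ measure_pmf.finite_measure_mono, of 0 P "{x}"]
    by (simp add: supp_def measure_inst)
next
  fix x assume x: "x \<in> supp (inst i j P i j)"
  show "x \<in> set_pmf P"
  proof (rule ccontr)
    assume "x \<notin> set_pmf P"
    moreover have "open (- set_pmf P)" using finite_imp_closed[OF assms] by (rule open_Compl)
    ultimately obtain e where "e > 0" "ball x e \<subseteq> - set_pmf P"
      using openE[of "- set_pmf P" x] by auto
    then have "measure_pmf.prob P (ball x e) = 0"
      by (auto simp: measure_pmf_zero_iff)
    then show False using x \<open>e > 0\<close> by (auto simp: supp_def measure_inst)
  qed
qed

lemma supp_inst_other:
  assumes "\<not> (k = i \<and> l = j)"
  shows "supp (inst i j P k l) = {1}"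
proof (intro set_eqI iffI)
  fix x assume "x \<in> supp (inst i j P k l)"
  then have *: "\<forall>e>0. (0::real) < indicator (ball x e) 1"
    using assms by (auto simp: supp_def measure_inst)
  show "x \<in> {1}"
  proof (rule ccontr)
    assume "x \<notin> {1}"
    then show False using *[rule_format, of "dist x 1"] by auto
  qed
next
  fix x :: real assume "x \<in> {1}"
  then show "x \<in> supp (inst i j P k l)" using assms by (auto simp: supp_def measure_inst)
qed

section \<open>Payments under dominant-strategy truthfulness\<close>

text \<open>The empty bundle may have positive value and is enjoyed by losers too; subtracting it
  leaves what winning item \<open>j\<close> adds.\<close>

definition marg :: "nat \<Rightarrow> valuation \<Rightarrow> nat \<Rightarrow> nat \<Rightarrow> real \<Rightarrow> real" where
  "marg m v i j x = x - v i (ivec m j x) {}"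

definition win_prob :: "nat \<Rightarrow> nat \<Rightarrow> mech \<Rightarrow> nat \<Rightarrow> nat \<Rightarrow> real \<Rightarrow> real" where
  "win_prob n m M i j x = measure_pmf.prob (fst M (prof n m i j x)) {a. a j = Some i}"

section \<open>Consequences of monotonicity and sub-additivity\<close>

lemma valuation_singleton:
  assumes v: "succinct_subadditive n m v" and i: "i < n" and x: "\<And>l. l < m \<Longrightarrow> 0 \<le> x l"
    and "j < m"
  shows "v i x {j} = x j"
  using assms unfolding succinct_subadditive_def by blast

lemma valuation_union:
  assumes v: "succinct_subadditive n m v" and i: "i < n" and x: "\<And>l. l < m \<Longrightarrow> 0 \<le> x l"
    and "S \<subseteq> {..<m}" "T \<subseteq> {..<m}"
  shows "v i x (S \<union> T) \<le> v i x S + v i x T"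
  using assms unfolding succinct_subadditive_def by blast

lemma subadditive_le_sum:
  assumes v: "succinct_subadditive n m v" and i: "i < n" and x: "\<And>l. l < m \<Longrightarrow> 0 \<le> x l"
    and S: "S \<subseteq> {..<m}" and F: "F \<subseteq> {..<m}"
  shows "v i x (S \<union> F) \<le> v i x S + (\<Sum>l\<in>F. x l)"
proof -
  have "finite F" using F finite_subset by blast
  then show ?thesis using F
  proof (induction F)
    case (insert l F)
    have "v i x ((S \<union> F) \<union> {l}) \<le> v i x (S \<union> F) + v i x {l}"
      using S insert.prems by (intro valuation_union[OF v i x]) auto
    moreover have "v i x {l} = x l"
      using insert.prems by (intro valuation_singleton[OF v i x]) auto
    moreover have "S \<union> insert l F = (S \<union> F) \<union> {l}" by auto
    ultimately show ?case using insert by auto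
  qed simp
qed

lemma valuation_mono:
  assumes v: "succinct_subadditive n m v" and i: "i < n" and x: "\<And>l. l < m \<Longrightarrow> 0 \<le> x l"
    and "S \<subseteq> T" "T \<subseteq> {..<m}"
  shows "v i x S \<le> v i x T"
proof -
  have "v i x S \<le> v i x (S \<union> T)"
    using assms unfolding succinct_subadditive_def by blast
  then show ?thesis using assms by (simp add: Un_absorb1)
qed

lemma valuation_nonneg:
  assumes v: "succinct_subadditive n m v" and i: "i < n" and x: "\<And>l. l < m \<Longrightarrow> 0 \<le> x l"
    and "S \<subseteq> {..<m}"
  shows "0 \<le> v i x S"
  using assms unfolding succinct_subadditive_def by blast

lemma bundle_of_subset: "bundle_of m i a \<subseteq> {..<m}"
  by (auto simp: bundle_of_def)

lemma finite_range_bundle_of: "finite (range (bundle_of m i))"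
  by (rule finite_subset[of _ "Pow {..<m}"]) (use bundle_of_subset in auto)

text \<open>A lottery may have infinite support, but only finitely many bundles occur, so every
  function of the bundle is bounded.\<close>

lemma integrable_bundle:
  "integrable (measure_pmf p) (\<lambda>a. (f (bundle_of m i a) :: real))"
proof (rule measure_pmf.integrable_const_bound[where B = "Max (range (\<lambda>a. \<bar>f (bundle_of m i a)\<bar>))"])
  have "range (\<lambda>a. \<bar>f (bundle_of m i a)\<bar>) = (\<lambda>S. \<bar>f S\<bar>) ` range (bundle_of m i)" by auto
  then have "finite (range (\<lambda>a. \<bar>f (bundle_of m i a)\<bar>))" using finite_range_bundle_of by simp
  then show "AE a in measure_pmf p. norm (f (bundle_of m i a)) \<le> Max (range (\<lambda>a. \<bar>f (bundle_of m i a)\<bar>))"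
    by (auto intro!: Max_ge)
qed simp

lemma restrict_items_player_vec [simp]: "restrict_items m (player_vec m b i) = player_vec m b i"
  by (auto simp: player_vec_def restrict_items_def)

lemma replace_report_same_row: "replace_report b i (\<lambda>l. b (i, l)) = b"
  by (auto simp: replace_report_def)

text \<open>The payment for the zero report is nonpositive, so individual rationality holds even relative
  to the value of the empty bundle, which the definition allows to be positive.\<close>
lemma DSIC_payment_le:
  assumes v: "succinct_subadditive n m v" and M: "DSIC n m v M" and i: "i < n" and m: "0 < m"
    and b: "nonneg_profile n m b"
  shows "snd M b i \<le> measure_pmf.expectation (fst M b) (\<lambda>a. v i (player_vec m b i) (bundle_of m i a))
           - v i (player_vec m b i) {}"
proof -
  let ?z = "\<lambda>_::nat. 0::real"
  let ?b = "replace_report b i ?z" and ?x = "player_vec m b i"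
  have x: "0 \<le> ?x l" for l
    using b i by (auto simp: nonneg_profile_def player_vec_def restrict_items_def)
  have b': "nonneg_profile n m ?b"
    using b by (auto simp: nonneg_profile_def replace_report_def)
  have pv: "player_vec m ?b i = ?z"
    by (auto simp: player_vec_def restrict_items_def replace_report_def)
  \<comment> \<open>At the zero vector every bundle, also the empty one, lies below its union with
    \<open>{0}\<close>, and that union is worth at most the singleton, which is worth 0.\<close>
  have "v i ?z S \<le> 0" if "S \<subseteq> {..<m}" for S
  proof -
    have "v i ?z ({0} \<union> S) \<le> v i ?z {0} + 0"
      using subadditive_le_sum[OF v i, of ?z "{0}" S] that m by simp
    moreover have "v i ?z S \<le> v i ?z ({0} \<union> S)"
      using that m by (intro valuation_mono[OF v i]) auto
    moreover have "v i ?z {0} = 0" using valuation_singleton[OF v i, of ?z 0] m by simp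
    ultimately show ?thesis by simp
  qed
  then have "measure_pmf.expectation (fst M ?b) (\<lambda>a. v i ?z (bundle_of m i a)) \<le>
      measure_pmf.expectation (fst M ?b) (\<lambda>a. 0)"
    by (intro integral_mono integrable_bundle) (auto simp: bundle_of_subset)
  moreover have "0 \<le> utility m v M i (player_vec m ?b i) ?b"
    using M b' i by (auto simp: DSIC_def)
  ultimately have z: "snd M ?b i \<le> 0"
    unfolding pv by (simp add: utility_def restrict_items_def)
  \<comment> \<open>Reporting zero yields at least the empty bundle at a nonpositive payment;
    truthfulness transfers this utility to the true report.\<close>
  have "measure_pmf.expectation (fst M ?b) (\<lambda>a. v i ?x {}) \<le>
      measure_pmf.expectation (fst M ?b) (\<lambda>a. v i ?x (bundle_of m i a))"
    by (intro integral_mono integrable_bundle valuation_mono[OF v i] x) (auto simp: bundle_of_def)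
  then have "v i ?x {} \<le> utility m v M i ?x ?b"
    using z by (simp add: utility_def)
  also have "\<dots> \<le> utility m v M i ?x b"
    using M b i by (auto simp: DSIC_def)
  finally show ?thesis by (simp add: utility_def)
qed

lemma nonneg_prof: "0 \<le> x \<Longrightarrow> nonneg_profile n m (prof n m i j x)"
  by (auto simp: nonneg_profile_def prof_def)

lemma player_vec_prof: "i < n \<Longrightarrow> player_vec m (prof n m i j x) i = ivec m j x"
  by (auto simp: player_vec_def ivec_def restrict_items_def prof_def fun_eq_iff)

lemma replace_report_prof:
  "replace_report (prof n m i j x) i (\<lambda>l. prof n m i j y (i, l)) = prof n m i j y"
  by (auto simp: replace_report_def prof_def fun_eq_iff)

lemma ivec_nonneg: "0 \<le> x \<Longrightarrow> 0 \<le> ivec m j x l"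
  by (auto simp: ivec_def restrict_items_def)

section \<open>Bundle values and payments when only one item value varies\<close>

context
  fixes n m :: nat and v :: valuation and i j :: nat
  assumes v: "succinct_subadditive n m v" and i: "i < n" and j: "j < m"
begin

text \<open>The lower bound is monotonicity. For the upper bound, the items other than
  \<open>j\<close> are worth at most 1 each, hence at most \<open>m\<close> together.\<close>

lemma valuation_bounds:
  assumes x: "0 \<le> x" and S: "S \<subseteq> {..<m}"
  shows "v i (ivec m j x) {} + marg m v i j x * indicator S j \<le> v i (ivec m j x) S"
    and "v i (ivec m j x) S \<le> v i (ivec m j x) {} + marg m v i j x * indicator S j + real m"
proof -
  have sj: "v i (ivec m j x) {j} = x"
    using valuation_singleton[OF v i ivec_nonneg[OF x] j] j by (simp add: ivec_def restrict_items_def)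
  show "v i (ivec m j x) {} + marg m v i j x * indicator S j \<le> v i (ivec m j x) S"
  proof (cases "j \<in> S")
    case True
    then have "v i (ivec m j x) {j} \<le> v i (ivec m j x) S"
      using S by (intro valuation_mono[OF v i ivec_nonneg[OF x]]) auto
    then show ?thesis using True sj by (simp add: marg_def)
  next
    case False
    then show ?thesis using valuation_mono[OF v i ivec_nonneg[OF x], of "{}" S] S by simp
  qed
  have "(\<Sum>l\<in>S - {j}. ivec m j x l) \<le> (\<Sum>l\<in>S - {j}. 1)"
    by (intro sum_mono) (auto simp: ivec_def restrict_items_def)
  also have "\<dots> \<le> real m"
    using card_mono[of "{..<m}" "S - {j}"] S by auto
  finally have s: "(\<Sum>l\<in>S - {j}. ivec m j x l) \<le> real m" .
  show "v i (ivec m j x) S \<le> v i (ivec m j x) {} + marg m v i j x * indicator S j + real m"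
  proof (cases "j \<in> S")
    case True
    then have "S = {j} \<union> (S - {j})" by auto
    moreover have "S - {j} \<subseteq> {..<m}" using S by auto
    ultimately have "v i (ivec m j x) S \<le> v i (ivec m j x) {j} + real m"
      using subadditive_le_sum[OF v i, of "ivec m j x" "{j}" "S - {j}"] ivec_nonneg[OF x] S s j
      by auto
    then show ?thesis using True sj by (simp add: marg_def)
  next
    case False
    then show ?thesis
      using subadditive_le_sum[OF v i, of "ivec m j x" "{}" S] ivec_nonneg[OF x] S s by auto
  qed
qed

lemma marg_le: "0 \<le> x \<Longrightarrow> marg m v i j x \<le> x"
  using valuation_nonneg[OF v i, of "ivec m j x" "{}"] ivec_nonneg[of x] by (simp add: marg_def)

lemma marg_nonneg:
  assumes x: "0 \<le> x"
  shows "0 \<le> marg m v i j x"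
proof -
  have "v i (ivec m j x) {} \<le> v i (ivec m j x) {j}"
    using j by (intro valuation_mono[OF v i ivec_nonneg[OF x]]) auto
  also have "\<dots> = x"
    using valuation_singleton[OF v i ivec_nonneg[OF x] j] j by (simp add: ivec_def restrict_items_def)
  finally show ?thesis by (simp add: marg_def)
qed

context
  fixes M :: mech
  assumes M: "DSIC n m v M"
begin

text \<open>The type \<open>x\<close> and the report \<open>y\<close> are separate, so that the
  bounds cover truthful reports as well as deviations.\<close>

lemma expectation_valuation_bounds:
  fixes x y :: real
  assumes x: "0 \<le> x"
  defines "E \<equiv> measure_pmf.expectation (fst M (prof n m i j y)) (\<lambda>a. v i (ivec m j x) (bundle_of m i a))"
  shows "v i (ivec m j x) {} + marg m v i j x * win_prob n m M i j y \<le> E"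
    and "E \<le> v i (ivec m j x) {} + marg m v i j x * win_prob n m M i j y + real m"
proof -
  let ?p = "fst M (prof n m i j y)"
  have w: "measure_pmf.expectation ?p (\<lambda>a. indicator (bundle_of m i a) j) = win_prob n m M i j y"
  proof -
    have "(\<lambda>a. indicator (bundle_of m i a) j :: real) = indicator {a. a j = Some i}"
      using j by (auto simp: bundle_of_def indicator_def fun_eq_iff)
    then show ?thesis by (simp add: win_prob_def)
  qed
  have e: "measure_pmf.expectation ?p (\<lambda>a. C + marg m v i j x * indicator (bundle_of m i a) j)
        = C + marg m v i j x * win_prob n m M i j y" for C
    using integrable_bundle[of ?p "\<lambda>S. indicator S j" m i] by (simp add: w)
  have "measure_pmf.expectation ?p (\<lambda>a. v i (ivec m j x) {} + marg m v i j x * indicator (bundle_of m i a) j) \<le> E"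
    unfolding E_def
    by (intro integral_mono integrable_bundle valuation_bounds bundle_of_subset x
        integrable_bundle[where f = "\<lambda>S. v i (ivec m j x) {} + marg m v i j x * indicator S j"])
  then show "v i (ivec m j x) {} + marg m v i j x * win_prob n m M i j y \<le> E" by (simp only: e)
  have "E \<le> measure_pmf.expectation ?p
      (\<lambda>a. (v i (ivec m j x) {} + real m) + marg m v i j x * indicator (bundle_of m i a) j)"
    unfolding E_def using valuation_bounds(2)[OF x bundle_of_subset[of m i]]
    by (intro integral_mono integrable_bundle
        integrable_bundle[where f = "\<lambda>S. (v i (ivec m j x) {} + real m) + marg m v i j x * indicator S j"])
      (auto simp: algebra_simps)
  then show "E \<le> v i (ivec m j x) {} + marg m v i j x * win_prob n m M i j y + real m"
    unfolding e by simp
qed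

lemma payment_le:
  assumes x: "0 \<le> x"
  shows "snd M (prof n m i j x) i \<le> marg m v i j x * win_prob n m M i j x + real m"
  using DSIC_payment_le[OF v M i _ nonneg_prof[OF x, of n m i j]] expectation_valuation_bounds(2)[OF x, of x] j
  by (simp add: player_vec_prof[OF i])

text \<open>This is the incentive constraint of type \<open>x\<close> against the report
  \<open>y\<close>. The truthful value is bounded from above and the deviating value from below, so
  the slack \<open>m\<close> enters once.\<close>

lemma payment_diff_le:
  assumes x: "0 \<le> x" and y: "0 \<le> y"
  shows "snd M (prof n m i j x) i - snd M (prof n m i j y) i \<le>
     marg m v i j x * (win_prob n m M i j x - win_prob n m M i j y) + real m"
proof -
  have "utility m v M i (ivec m j x) (prof n m i j y) \<le> utility m v M i (ivec m j x) (prof n m i j x)"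
  proof -
    have "\<forall>l<m. 0 \<le> prof n m i j y (i, l)"
      using y by (auto simp: prof_def i)
    then show ?thesis
      using M nonneg_prof[OF x] i unfolding DSIC_def
      by (metis player_vec_prof[OF i] replace_report_prof)
  qed
  moreover have "restrict_items m (ivec m j x) = ivec m j x"
    by (auto simp: ivec_def restrict_items_def)
  ultimately show ?thesis
    using expectation_valuation_bounds(1)[OF x, of y] expectation_valuation_bounds(2)[OF x, of x]
    by (simp add: utility_def algebra_simps)
qed

text \<open>All item values of the other players are 1, so each of them pays at most the expected
  number of items won; the bundles are disjoint, so these numbers add up to at most
  \<open>m\<close>.\<close>

lemma other_payments_le:
  assumes x: "0 \<le> x"
  shows "(\<Sum>k\<in>{..<n} - {i}. snd M (prof n m i j x) k) \<le> real m"
proof -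
  let ?b = "prof n m i j x"
  let ?p = "fst M ?b"
  have 1: "snd M ?b k \<le> measure_pmf.expectation ?p (\<lambda>a. real (card (bundle_of m k a)))"
    if k: "k \<in> {..<n} - {i}" for k
  proof -
    have kn: "k < n" using k by simp
    have pv: "player_vec m ?b k l = (if l < m then 1 else 0)" for l
      using k by (auto simp: player_vec_def restrict_items_def prof_def)
    have "v k (player_vec m ?b k) S - v k (player_vec m ?b k) {} \<le> real (card S)"
      if "S \<subseteq> {..<m}" for S
    proof -
      have "v k (player_vec m ?b k) ({} \<union> S) \<le> v k (player_vec m ?b k) {} + (\<Sum>l\<in>S. player_vec m ?b k l)"
        using that by (intro subadditive_le_sum[OF v kn]) (auto simp: pv)
      also have "(\<Sum>l\<in>S. player_vec m ?b k l) = (\<Sum>l\<in>S. 1)"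
        using that by (intro sum.cong) (auto simp: pv)
      finally show ?thesis by simp
    qed
    then have "measure_pmf.expectation ?p (\<lambda>a. v k (player_vec m ?b k) (bundle_of m k a) - v k (player_vec m ?b k) {})
       \<le> measure_pmf.expectation ?p (\<lambda>a. real (card (bundle_of m k a)))"
      by (intro integral_mono integrable_bundle
          integrable_bundle[where f = "\<lambda>S. v k (player_vec m ?b k) S - v k (player_vec m ?b k) {}"]
          integrable_bundle[where f = "\<lambda>S. real (card S)"]) (simp add: bundle_of_subset)
    moreover have "measure_pmf.expectation ?p (\<lambda>a. v k (player_vec m ?b k) (bundle_of m k a) - v k (player_vec m ?b k) {})
       = measure_pmf.expectation ?p (\<lambda>a. v k (player_vec m ?b k) (bundle_of m k a)) - v k (player_vec m ?b k) {}"
      by (subst Bochner_Integration.integral_diff) (auto intro: integrable_bundle)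
    ultimately show ?thesis
      using DSIC_payment_le[OF v M kn _ nonneg_prof[OF x, of n m i j]] j by simp
  qed
  have "(\<Sum>k\<in>{..<n} - {i}. snd M ?b k) \<le>
      (\<Sum>k\<in>{..<n} - {i}. measure_pmf.expectation ?p (\<lambda>a. real (card (bundle_of m k a))))"
    by (intro sum_mono 1)
  also have "\<dots> = measure_pmf.expectation ?p (\<lambda>a. \<Sum>k\<in>{..<n} - {i}. real (card (bundle_of m k a)))"
    by (intro Bochner_Integration.integral_sum[symmetric] integrable_bundle[where f = "\<lambda>S. real (card S)"])
  also have "\<dots> \<le> measure_pmf.expectation ?p (\<lambda>a. real m)"
  proof (intro integral_mono Bochner_Integration.integrable_sum integrable_bundle[where f = "\<lambda>S. real (card S)"])
    fix a
    have "(\<Sum>k\<in>{..<n} - {i}. card (bundle_of m k a)) = card (\<Union>k\<in>{..<n} - {i}. bundle_of m k a)"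
      by (intro card_UN_disjoint[symmetric]) (auto simp: bundle_of_def)
    also have "\<dots> \<le> card {..<m}"
      by (intro card_mono) (auto simp: bundle_of_def)
    finally show "(\<Sum>k\<in>{..<n} - {i}. real (card (bundle_of m k a))) \<le> real m"
      by (simp flip: of_nat_sum)
  qed simp
  finally show ?thesis by simp
qed

lemma total_payment_le:
  assumes x: "0 \<le> x"
  shows "(\<Sum>k<n. snd M (prof n m i j x) k) \<le> snd M (prof n m i j x) i + real m"
  using other_payments_le[OF x] sum.remove[of "{..<n}" i "snd M (prof n m i j x)"] i by simp

end

end

lemma win_prob_bounds: "0 \<le> win_prob n m M i j x" "win_prob n m M i j x \<le> 1"
  by (simp_all add: win_prob_def)

section \<open>Lower bounds on the optimal revenue\<close>

lemma typespace_inst: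
  assumes "finite (set_pmf P)" "i < n" "j < m"
  shows "t \<in> typespace m (inst i j P) k \<longleftrightarrow>
    (\<forall>l<m. if k = i \<and> l = j then t l \<in> set_pmf P else t l = 1)"
proof -
  have "supp (inst i j P k l) = (if k = i \<and> l = j then set_pmf P else {1})" for l
    using supp_inst[OF assms(1), of i j] supp_inst_other[of k i l j P] by simp
  then show ?thesis by (auto simp: typespace_def)
qed

lemma utility_le:
  assumes v: "succinct_subadditive n m v" and k: "k < n" and t: "\<And>l. l < m \<Longrightarrow> 0 \<le> t l"
  shows "utility m v M k t b \<le> v k (restrict_items m t) {..<m} - snd M b k"
proof -
  have "measure_pmf.expectation (fst M b) (\<lambda>a. v k (restrict_items m t) (bundle_of m k a)) \<le>
      measure_pmf.expectation (fst M b) (\<lambda>a. v k (restrict_items m t) {..<m})"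
    by (intro integral_mono integrable_bundle valuation_mono[OF v k])
      (auto simp: bundle_of_def restrict_items_def t)
  then show ?thesis by (simp add: utility_def)
qed

text \<open>Interim individual rationality bounds expected payments by the value of all items. The
  bound is crude; it serves to make the supremum in \<open>OPT\<close> one of a bounded set, so that
  single mechanisms bound \<open>OPT\<close> from below.\<close>

lemma BIC_revenue_le:
  assumes v: "succinct_subadditive n m v" and i: "i < n" and j: "j < m"
    and fin: "finite (set_pmf P)" and pos: "set_pmf P \<subseteq> {0..}"
    and M: "BIC n m v (inst i j P) M"
  shows "Rev n m (inst i j P) M \<le>
    (\<Sum>k<n. measure_pmf.expectation P (\<lambda>x. v k (player_vec m (prof n m i j x) k) {..<m}))"
proof -
  let ?N = "prior n m (inst i j P)" and ?b = "prof n m i j"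
  note intP = integrable_measure_pmf_finite[OF fin]
  have meas: "f \<in> borel_measurable (profiles n m)" if "integrable ?N f" for f :: "profile \<Rightarrow> real"
    using borel_measurable_integrable[OF that] by (simp add: borel_measurable_prior_inst i j)
  have int: "(\<integral>b. f b \<partial>?N) = measure_pmf.expectation P (\<lambda>x. f (?b x))" if "integrable ?N f" for f :: "profile \<Rightarrow> real"
    by (rule integral_prior_inst[OF i j meas[OF that]])
  have pay: "integrable ?N (\<lambda>b. snd M b k)" if "k < n" for k
    using M that by (simp add: BIC_def)
  have bound: "measure_pmf.expectation P (\<lambda>x. snd M (?b x) k) \<le>
      measure_pmf.expectation P (\<lambda>x. v k (player_vec m (?b x) k) {..<m})" if k: "k < n" for k
  proof -
    define t where "t x = (\<lambda>l. ?b x (k, l))" for x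
    have tt: "t x \<in> typespace m (inst i j P) k" if "x \<in> set_pmf P" for x
      using that k by (auto simp: typespace_inst[OF fin i j] t_def prof_def)
    have tn: "0 \<le> t x l" if "x \<in> set_pmf P" "l < m" for x l
      using that k pos by (auto simp: t_def prof_def)
    have rt: "restrict_items m (t x) = player_vec m (?b x) k" for x
      by (simp add: t_def player_vec_def)
    have u: "0 \<le> measure_pmf.expectation P (\<lambda>y. utility m v M k (t x) (replace_report (?b y) k (t x)))"
      if "x \<in> set_pmf P" for x
    proof -
      have "integrable ?N (\<lambda>b. utility m v M k (t x) (replace_report b k (t x)))"
        "0 \<le> (\<integral>b. utility m v M k (t x) (replace_report b k (t x)) \<partial>?N)"
        using M k tt[OF that] unfolding BIC_def by blast+
      then show ?thesis using int by simp
    qed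
    have ul: "utility m v M k (t x) b \<le> v k (player_vec m (?b x) k) {..<m} - snd M b k"
      if "x \<in> set_pmf P" for x b
      using utility_le[OF v k, of "t x"] tn[OF that] by (simp add: rt)
    show ?thesis
    proof (cases "k = i")
      case True
      \<comment> \<open>All randomness sits in the row of player \<open>i\<close>; once this row is
        fixed, the interim constraint holds pointwise.\<close>
      have "replace_report (?b y) k (t x) = ?b x" for x y
        by (auto simp: True t_def replace_report_def prof_def fun_eq_iff)
      then have "0 \<le> utility m v M k (t x) (?b x)" if "x \<in> set_pmf P" for x
        using u[OF that] by simp
      then have "snd M (?b x) k \<le> v k (player_vec m (?b x) k) {..<m}" if "x \<in> set_pmf P" for x
        using ul[OF that, of "?b x"] that by fastforce
      then show ?thesis
        by (intro integral_mono_AE intP) (auto simp: AE_measure_pmf_iff)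
    next
      case False
      \<comment> \<open>A player other than \<open>i\<close> has a single type, so the replaced
        profile is the true one and the interim constraint is an average over
        \<open>P\<close>.\<close>
      have tc: "t x = t y" for x y
        using False by (auto simp: t_def prof_def fun_eq_iff)
      have rr: "replace_report (?b y) k (t x) = ?b y" for x y
        unfolding tc[of x y] unfolding t_def by (rule replace_report_same_row)
      obtain x where x: "x \<in> set_pmf P" using set_pmf_not_empty[of P] by blast
      have "0 \<le> measure_pmf.expectation P (\<lambda>y. utility m v M k (t x) (?b y))"
        using u[OF x] by (simp only: rr)
      also have "\<dots> \<le> measure_pmf.expectation P
          (\<lambda>y. v k (player_vec m (?b y) k) {..<m} - snd M (?b y) k)"
      proof (intro integral_mono_AE intP)
        have "utility m v M k (t x) (?b y) \<le> v k (player_vec m (?b y) k) {..<m} - snd M (?b y) k"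
          if "y \<in> set_pmf P" for y
          using ul[OF that, of "?b y"] unfolding tc[of x y] .
        then show "AE y in measure_pmf P. utility m v M k (t x) (?b y) \<le>
            v k (player_vec m (?b y) k) {..<m} - snd M (?b y) k"
          by (simp add: AE_measure_pmf_iff)
      qed
      also have "\<dots> = measure_pmf.expectation P (\<lambda>y. v k (player_vec m (?b y) k) {..<m})
          - measure_pmf.expectation P (\<lambda>y. snd M (?b y) k)"
        by (intro Bochner_Integration.integral_diff intP)
      finally show ?thesis by simp
    qed
  qed
  have "Rev n m (inst i j P) M = (\<Sum>k<n. \<integral>b. snd M b k \<partial>?N)"
    unfolding Rev_def using pay by (intro Bochner_Integration.integral_sum) auto
  also have "\<dots> = (\<Sum>k<n. measure_pmf.expectation P (\<lambda>x. snd M (?b x) k))"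
    using pay by (intro sum.cong int) auto
  finally show ?thesis using bound by (auto intro: sum_mono)
qed

text \<open>The threshold \<open>\<theta>\<close> is on the scale of item values while the price
  \<open>\<pi>\<close> is on the scale of \<open>marg\<close>. With a known value the price may even
  exceed \<open>marg\<close>.\<close>

definition posted :: "nat \<Rightarrow> nat \<Rightarrow> real \<Rightarrow> real \<Rightarrow> mech" where
  "posted i j \<theta> \<pi> =
     (\<lambda>b. return_pmf (if \<theta> \<le> b (i, j) then (\<lambda>l. if l = j then Some i else None) else (\<lambda>_. None)),
      \<lambda>b k. if k = i \<and> \<theta> \<le> b (i, j) then \<pi> else 0)"

lemma utility_posted:
  assumes "j < m"
  shows "utility m v (posted i j \<theta> \<pi>) k t b =
    (if k = i \<and> \<theta> \<le> b (i, j) then v i (restrict_items m t) {j} - \<pi> else v k (restrict_items m t) {})"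
proof -
  have "bundle_of m k (if \<theta> \<le> b (i, j) then (\<lambda>l. if l = j then Some i else None) else (\<lambda>_. None)) =
      (if k = i \<and> \<theta> \<le> b (i, j) then {j} else {})"
    using assms by (auto simp: bundle_of_def)
  then show ?thesis by (auto simp: utility_def posted_def)
qed

section \<open>Posted prices on an instance with one random value\<close>

context
  fixes n m :: nat and v :: valuation and i j :: nat and P :: "real pmf" and \<theta> \<pi> :: real
  assumes v: "succinct_subadditive n m v" and i: "i < n" and j: "j < m"
    and fin: "finite (set_pmf P)" and pos: "set_pmf P \<subseteq> {0..}"
    and IR: "\<And>x. x \<in> set_pmf P \<Longrightarrow> \<theta> \<le> x \<Longrightarrow> \<pi> \<le> x"
    and buy: "\<And>x y. x \<in> set_pmf P \<Longrightarrow> y \<in> set_pmf P \<Longrightarrow> \<theta> \<le> x \<Longrightarrow> y < \<theta> \<Longrightarrow> \<pi> \<le> marg m v i j x"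
    and refuse: "\<And>x y. x \<in> set_pmf P \<Longrightarrow> y \<in> set_pmf P \<Longrightarrow> x < \<theta> \<Longrightarrow> \<theta> \<le> y \<Longrightarrow> marg m v i j x \<le> \<pi>"
begin

lemma measurable_posted_payment:
  "(\<lambda>b. snd (posted i j \<theta> \<pi>) b k) \<in> borel_measurable (profiles n m)"
proof -
  have [measurable]: "(\<lambda>b. b (i, j)) \<in> borel_measurable (profiles n m)"
    using i j by (intro measurable_component_singleton) auto
  show ?thesis unfolding posted_def by simp
qed

text \<open>BIC compares types of the support only, and a misreport matters only if it crosses
  \<open>\<theta>\<close>. So \<open>buy\<close> and \<open>refuse\<close> are conditions on
  supports that meet both sides of \<open>\<theta>\<close>.\<close>

lemma BIC_posted: "BIC n m v (inst i j P) (posted i j \<theta> \<pi>)"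
proof -
  let ?N = "prior n m (inst i j P)" and ?M = "posted i j \<theta> \<pi>"
  interpret N: prob_space ?N by (rule prob_space_prior_inst[OF i j])
  have feas: "feasible_mech n m ?M"
    using i j by (auto simp: feasible_mech_def posted_def feasible_alloc_def)
  have pay: "integrable ?N (\<lambda>b. snd ?M b k)" for k
  proof (rule N.integrable_const_bound[where B = "\<bar>\<pi>\<bar>"])
    show "(\<lambda>b. snd ?M b k) \<in> borel_measurable ?N"
      unfolding borel_measurable_prior_inst[OF i j] by (rule measurable_posted_payment)
  qed (auto simp: posted_def)
  have ty: "0 \<le> restrict_items m t l" if "t \<in> typespace m (inst i j P) k" for t k l
    using that pos by (fastforce simp: typespace_inst[OF fin i j] restrict_items_def split: if_splits)
  have val: "v i (restrict_items m t) {j} = t j" if "t \<in> typespace m (inst i j P) i" for t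
    using valuation_singleton[OF v i ty[OF that] j] j by (simp add: restrict_items_def)
  have iv: "restrict_items m t = ivec m j (t j)" if "t \<in> typespace m (inst i j P) i" for t
    using that by (auto simp: typespace_inst[OF fin i j] restrict_items_def ivec_def fun_eq_iff)
  have inP: "t j \<in> set_pmf P" if "t \<in> typespace m (inst i j P) i" for t
    using that j by (auto simp: typespace_inst[OF fin i j])
  have u: "utility m v ?M k t (replace_report b k t') =
      (if k = i then if \<theta> \<le> t' j then t j - \<pi> else v i (restrict_items m t) {}
       else v k (restrict_items m t) {})"
    if "k < n" "k \<noteq> i \<or> t \<in> typespace m (inst i j P) i" for k t t' b
    using that j val by (auto simp: utility_posted replace_report_def)
  have nn: "0 \<le> v k (restrict_items m t) {}" if "k < n" "t \<in> typespace m (inst i j P) k" for k t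
    using valuation_nonneg[OF v that(1) ty[OF that(2)], of "{}"] by simp
  have mg: "marg m v i j (t j) = t j - v i (restrict_items m t) {}"
    if "t \<in> typespace m (inst i j P) i" for t
    using iv[OF that] by (simp add: marg_def)
  have "integrable ?N (\<lambda>b. utility m v ?M k t (replace_report b k t)) \<and>
      integrable ?N (\<lambda>b. utility m v ?M k t (replace_report b k t')) \<and>
      0 \<le> (\<integral>b. utility m v ?M k t (replace_report b k t) \<partial>?N) \<and>
      (\<integral>b. utility m v ?M k t (replace_report b k t') \<partial>?N)
        \<le> (\<integral>b. utility m v ?M k t (replace_report b k t) \<partial>?N)"
    if k: "k < n" and t: "t \<in> typespace m (inst i j P) k" and t': "t' \<in> typespace m (inst i j P) k"
    for k t t'
  proof (cases "k = i")
    case True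
    note ti = t[unfolded True] and ti' = t'[unfolded True]
    show ?thesis
      using u[OF i, of t] True ti nn[OF i ti] IR[OF inP[OF ti]] mg[OF ti]
        buy[OF inP[OF ti] inP[OF ti']] refuse[OF inP[OF ti] inP[OF ti']]
      by (auto simp: N.prob_space)
  next
    case False
    then show ?thesis using u[OF k, of t] nn[OF k t] by (auto simp: N.prob_space)
  qed
  then show ?thesis using feas pay by (auto simp: BIC_def)
qed

lemma OPT_ge_posted: "\<pi> * measure_pmf.prob P {\<theta>..} \<le> OPT n m v (inst i j P)"
proof -
  let ?M = "posted i j \<theta> \<pi>"
  have "(\<Sum>k<n. snd ?M b k) = \<pi> * indicator {\<theta>..} (b (i, j))" for b
    using i by (auto simp: posted_def indicator_def if_distrib[of "\<lambda>f. f _"] sum.If_cases)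
  then have "Rev n m (inst i j P) ?M = measure_pmf.expectation P (\<lambda>x. \<pi> * indicator {\<theta>..} x)"
    using measurable_posted_payment i j
    by (subst Rev_inst) (auto simp: prof_def intro!: borel_measurable_sum)
  then have "Rev n m (inst i j P) ?M = \<pi> * measure_pmf.prob P {\<theta>..}" by simp
  moreover have "Rev n m (inst i j P) ?M \<le> OPT n m v (inst i j P)"
    unfolding OPT_def
  proof (rule cSup_upper)
    show "bdd_above {Rev n m (inst i j P) M |M. BIC n m v (inst i j P) M}"
      using BIC_revenue_le[OF v i j fin pos] by (intro bdd_aboveI) blast
  qed (use BIC_posted in blast)
  ultimately show ?thesis by simp
qed

end

section \<open>Equal-revenue tails with a hidden bump\<close>

text \<open>For a \<open>tail_fun\<close>, this is the law on indices that gives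
  \<open>{k..}\<close> probability \<open>T k\<close>.\<close>

definition tail_pmf :: "(nat \<Rightarrow> real) \<Rightarrow> nat pmf" where
  "tail_pmf T = embed_pmf (\<lambda>k. T k - T (Suc k))"

definition level :: "(nat \<Rightarrow> real) \<Rightarrow> real \<Rightarrow> nat" where
  "level x z = (LEAST k. z \<le> x k)"

lemma le_iff_level_le:
  fixes x :: "nat \<Rightarrow> real"
  assumes "mono x" and "\<exists>k. z \<le> x k"
  shows "z \<le> x k \<longleftrightarrow> level x z \<le> k"
proof
  show "z \<le> x k \<Longrightarrow> level x z \<le> k" unfolding level_def by (rule Least_le)
  assume "level x z \<le> k"
  moreover have "z \<le> x (level x z)" unfolding level_def using assms(2) by (rule LeastI_ex)
  ultimately show "z \<le> x k" using monoD[OF assms(1)] order_trans by blast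
qed

lemma sum_by_parts:
  fixes T f :: "nat \<Rightarrow> real"
  shows "(\<Sum>k\<le>K. (T k - T (Suc k)) * f k) =
    T 0 * f 0 + (\<Sum>k<K. T (Suc k) * (f (Suc k) - f k)) - T (Suc K) * f K"
  by (induction K) (auto simp: algebra_simps)

section \<open>Laws given by their tails on a scale of indices\<close>

locale tail_fun =
  fixes T :: "nat \<Rightarrow> real" and K :: nat
  assumes decr: "T (Suc k) \<le> T k" and T0: "T 0 = 1" and beyond: "K < k \<Longrightarrow> T k = 0"
begin

lemma pmf_tail_pmf: "pmf (tail_pmf T) k = T k - T (Suc k)"
  unfolding tail_pmf_def
proof (rule pmf_embed_pmf)
  show "0 \<le> T k - T (Suc k)" for k using decr[of k] by simp
  have "(\<integral>\<^sup>+ k. ennreal (T k - T (Suc k)) \<partial>count_space UNIV) = (\<Sum>k\<le>K. ennreal (T k - T (Suc k)))"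
    by (rule nn_integral_count_space'[where A = "{..K}"]) (auto simp: beyond not_le)
  also have "\<dots> = ennreal (\<Sum>k\<le>K. T k - T (Suc k))"
    using decr by (intro sum_ennreal) auto
  also have "(\<Sum>k\<le>K. T k - T (Suc k)) = 1"
    using sum_by_parts[of T "\<lambda>_. 1" K] by (simp add: T0 beyond)
  finally show "(\<integral>\<^sup>+ k. ennreal (T k - T (Suc k)) \<partial>count_space UNIV) = 1" by simp
qed

lemma set_tail_pmf: "set_pmf (tail_pmf T) \<subseteq> {..K}"
  by (auto simp: set_pmf_iff pmf_tail_pmf beyond intro!: leI)

lemma prob_tail_pmf: "measure_pmf.prob (tail_pmf T) {k..} = T k"
proof -
  have "measure_pmf.prob (tail_pmf T) {..<k} = (\<Sum>l<k. T l - T (Suc l))"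
    by (subst measure_measure_pmf_finite) (auto simp: pmf_tail_pmf)
  also have "\<dots> = 1 - T k" by (simp add: sum_lessThan_telescope' T0)
  finally show ?thesis
    using measure_pmf.prob_compl[of "{..<k}" "tail_pmf T"] by (simp add: Compl_eq_Diff_UNIV[symmetric] not_less)
qed

lemma prob_scaled_tail:
  assumes "mono x" and "\<exists>k. z \<le> x k"
  shows "measure_pmf.prob (map_pmf x (tail_pmf T)) {z..} = T (level x z)"
proof -
  have "x -` {z..} = {level x z..}" using le_iff_level_le[OF assms] by auto
  then show ?thesis by (simp add: prob_tail_pmf)
qed

text \<open>Summation by parts with \<open>T 0 = 1\<close> and \<open>T (Suc K) = 0\<close>.
  Incentive constraints control increments of payments, so expectations are needed in terms of
  increments.\<close>

lemma expectation_scaled_tail: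
  "measure_pmf.expectation (map_pmf x (tail_pmf T)) (f :: real \<Rightarrow> real) =
    f (x 0) + (\<Sum>k<K. T (Suc k) * (f (x (Suc k)) - f (x k)))"
proof -
  have "measure_pmf.expectation (map_pmf x (tail_pmf T)) f =
      (\<Sum>k\<le>K. f (x k) * pmf (tail_pmf T) k)"
    unfolding integral_map_pmf using set_tail_pmf by (intro integral_measure_pmf_real) auto
  also have "\<dots> = (\<Sum>k\<le>K. (T k - T (Suc k)) * f (x k))"
    by (simp add: pmf_tail_pmf mult.commute)
  finally show ?thesis using sum_by_parts[of T "\<lambda>k. f (x k)" K] by (simp add: T0 beyond)
qed

lemma finite_set_scaled_tail: "finite (set_pmf (map_pmf x (tail_pmf T)))"
  using finite_subset[OF set_tail_pmf] by simp

lemma nonneg: "0 \<le> T k"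
proof -
  have "T k = measure_pmf.prob (tail_pmf T) {k..}" by (simp add: prob_tail_pmf)
  then show ?thesis by simp
qed

text \<open>\<open>payment_le\<close> is applied at the lowest scale and
  \<open>payment_diff_le\<close> between neighbouring scales. The slack \<open>m\<close> arises
  twice at the bottom, once from player \<open>i\<close> and once from the other players, and once
  per increment, weighted by the tail.\<close>

lemma DSIC_expected_payment_le:
  assumes v: "succinct_subadditive n m v" and M: "DSIC n m v M" and i: "i < n" and j: "j < m"
    and x: "\<And>k. 0 \<le> x k"
  defines "w \<equiv> \<lambda>k. marg m v i j (x k)" and "q \<equiv> \<lambda>k. win_prob n m M i j (x k)"
  shows "measure_pmf.expectation (map_pmf x (tail_pmf T)) (\<lambda>y. \<Sum>k<n. snd M (prof n m i j y) k)
    \<le> w 0 * q 0 + (\<Sum>k<K. T (Suc k) * w (Suc k) * (q (Suc k) - q k))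
       + real m * (2 + (\<Sum>k<K. T (Suc k)))"
proof -
  let ?P = "map_pmf x (tail_pmf T)"
  let ?p = "\<lambda>y. snd M (prof n m i j y) i"
  have "measure_pmf.expectation ?P (\<lambda>y. \<Sum>k<n. snd M (prof n m i j y) k)
      \<le> measure_pmf.expectation ?P (\<lambda>y. ?p y + real m)"
    using total_payment_le[OF v i j M x]
    by (intro integral_mono_AE integrable_measure_pmf_finite finite_set_scaled_tail)
      (auto simp: AE_measure_pmf_iff)
  also have "\<dots> = ?p (x 0) + real m + (\<Sum>k<K. T (Suc k) * (?p (x (Suc k)) - ?p (x k)))"
    unfolding expectation_scaled_tail by simp
  also have "\<dots> \<le> (w 0 * q 0 + real m) + real m +
      (\<Sum>k<K. T (Suc k) * (w (Suc k) * (q (Suc k) - q k) + real m))"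
    unfolding w_def q_def using nonneg
    by (intro add_mono sum_mono mult_left_mono payment_le[OF v i j M x]
        payment_diff_le[OF v i j M x x] order_refl) auto
  also have "\<dots> = w 0 * q 0 + (\<Sum>k<K. T (Suc k) * w (Suc k) * (q (Suc k) - q k))
       + real m * (2 + (\<Sum>k<K. T (Suc k)))"
    unfolding distrib_left sum.distrib sum_distrib_left by (simp add: mult_ac)
  finally show ?thesis .
qed

end

text \<open>Each posted price \<open>w k\<close> with \<open>k \<le> K\<close> sells with
  probability \<open>w 0 / w k\<close> and so earns \<open>w 0\<close>.\<close>

definition equal_revenue_tail :: "nat \<Rightarrow> (nat \<Rightarrow> real) \<Rightarrow> nat \<Rightarrow> real" where
  "equal_revenue_tail K w k = (if k \<le> K then w 0 / w k else 0)"

text \<open>Only the tail at the single index \<open>Suc \<kappa>\<close> changes, which keeps the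
  bump hidden from most queries.\<close>

definition bumped_tail :: "nat \<Rightarrow> (nat \<Rightarrow> real) \<Rightarrow> nat \<Rightarrow> nat \<Rightarrow> real" where
  "bumped_tail K w \<kappa> = (equal_revenue_tail K w)(Suc \<kappa> := equal_revenue_tail K w \<kappa>)"

text \<open>Doubling bounds the tails by a geometric sequence, so the slacks \<open>m\<close> along
  the scale sum to a multiple of \<open>m\<close> that is independent of \<open>K\<close>.\<close>

locale doubling =
  fixes w :: "nat \<Rightarrow> real" and K :: nat
  assumes w0: "0 < w 0" and doubling: "k < K \<Longrightarrow> 2 * w k \<le> w (Suc k)"
begin

lemma w_ge: "k \<le> K \<Longrightarrow> 2 ^ k * w 0 \<le> w k"
proof (induction k)
  case (Suc k)
  then show ?case using doubling[of k] by simp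
qed simp

lemma w_pos: "k \<le> K \<Longrightarrow> 0 < w k"
  using w_ge[of k] w0 by (smt (verit) mult_pos_pos zero_less_power)

lemma w_less: "k < K \<Longrightarrow> w k < w (Suc k)"
  using doubling[of k] w_pos[of k] by simp

lemma w_mono: "k \<le> l \<Longrightarrow> l \<le> K \<Longrightarrow> w k \<le> w l"
proof (induction l rule: dec_induct)
  case (step l)
  then show ?case using w_less[of l] by simp
qed simp

lemma equal_revenue_tail_decr: "equal_revenue_tail K w (Suc k) \<le> equal_revenue_tail K w k"
  using w_less[of k] w_pos[of k] w0
  by (auto simp: equal_revenue_tail_def intro!: divide_left_mono mult_pos_pos)

sublocale tail_fun "equal_revenue_tail K w" K
  using equal_revenue_tail_decr w0 by unfold_locales (auto simp: equal_revenue_tail_def)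

lemma bumped_tail_fun:
  assumes "\<kappa> < K"
  shows "tail_fun (bumped_tail K w \<kappa>) K"
proof
  show "bumped_tail K w \<kappa> (Suc k) \<le> bumped_tail K w \<kappa> k" for k
    using decr[of k] decr[of \<kappa>] decr[of "Suc \<kappa>"] by (auto simp: bumped_tail_def)
qed (use assms T0 beyond in \<open>auto simp: bumped_tail_def\<close>)

lemma tail_le: "equal_revenue_tail K w k \<le> (1/2) ^ k"
  using w_ge[of k] w_pos[of k] by (auto simp: equal_revenue_tail_def field_simps power_divide)

lemma sum_bumped_tail: "(\<Sum>k<K. bumped_tail K w \<kappa> (Suc k)) \<le> 2"
proof -
  have "(\<Sum>k<K. bumped_tail K w \<kappa> (Suc k)) \<le> (\<Sum>k<K. (1/2) ^ k)"
  proof (intro sum_mono)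
    fix k
    have "bumped_tail K w \<kappa> (Suc k) \<le> equal_revenue_tail K w k"
      using decr[of k] by (auto simp: bumped_tail_def)
    then show "bumped_tail K w \<kappa> (Suc k) \<le> (1/2) ^ k" using tail_le[of k] by simp
  qed
  also have "\<dots> \<le> 2" by (simp add: sum_gp_strict)
  finally show ?thesis .
qed

text \<open>The normalization \<open>w 0 * \<rho>\<close> is what posting the price
  \<open>w (Suc \<kappa>)\<close> earns. The products of tail and \<open>w\<close> are all
  \<open>w 0\<close> except at the bump, so the winning probabilities telescope apart from one
  weighted increment.\<close>

lemma bumped_DSIC_expected_payment_le:
  assumes v: "succinct_subadditive n m v" and M: "DSIC n m v M" and i: "i < n" and j: "j < m"
    and x: "\<And>k. 0 \<le> x k" and w: "\<And>k. w k = marg m v i j (x k)" and \<kappa>: "\<kappa> < K"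
    and large: "4 * real m \<le> w 0"
  defines "q \<equiv> \<lambda>k. win_prob n m M i j (x k)" and "\<rho> \<equiv> w (Suc \<kappa>) / w \<kappa>"
  shows "measure_pmf.expectation (map_pmf x (tail_pmf (bumped_tail K w \<kappa>)))
      (\<lambda>y. \<Sum>k<n. snd M (prof n m i j y) k) / (w 0 * \<rho>) \<le> 3 / \<rho> + (q (Suc \<kappa>) - q \<kappa>)"
proof -
  let ?T = "bumped_tail K w \<kappa>"
  interpret B: tail_fun ?T K by (rule bumped_tail_fun[OF \<kappa>])
  let ?E = "measure_pmf.expectation (map_pmf x (tail_pmf ?T)) (\<lambda>y. \<Sum>k<n. snd M (prof n m i j y) k)"
  have \<rho>: "2 \<le> \<rho>" using doubling[OF \<kappa>] w_pos[of \<kappa>] \<kappa> by (simp add: \<rho>_def field_simps)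
  have q01: "0 \<le> q k" "q k \<le> 1" for k by (simp_all add: q_def win_prob_bounds)
  have Tw: "?T (Suc k) * w (Suc k) = w 0 + (if k = \<kappa> then w 0 * (\<rho> - 1) else 0)" if "k < K" for k
    using w_pos[of k] w_pos[of "Suc k"] that \<kappa>
    by (auto simp: bumped_tail_def equal_revenue_tail_def \<rho>_def field_simps)
  have "?E \<le> w 0 * q 0 + (\<Sum>k<K. ?T (Suc k) * w (Suc k) * (q (Suc k) - q k))
       + real m * (2 + (\<Sum>k<K. ?T (Suc k)))"
    using B.DSIC_expected_payment_le[OF v M i j, of x, OF x] by (simp add: w q_def)
  also have "(\<Sum>k<K. ?T (Suc k) * w (Suc k) * (q (Suc k) - q k)) =
      (\<Sum>k<K. w 0 * (q (Suc k) - q k) + (if k = \<kappa> then w 0 * (\<rho> - 1) * (q (Suc k) - q k) else 0))"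
    by (intro sum.cong) (auto simp only: lessThan_iff Tw distrib_right if_distrib[of "\<lambda>x. x * _"] mult_zero_left)
  also have "\<dots> = w 0 * (q K - q 0) + w 0 * (\<rho> - 1) * (q (Suc \<kappa>) - q \<kappa>)"
    using \<kappa> by (simp add: sum.distrib sum_distrib_left[symmetric] sum_lessThan_telescope)
  also have "real m * (2 + (\<Sum>k<K. ?T (Suc k))) \<le> real m * 4"
    using sum_bumped_tail[of \<kappa>] by (intro mult_left_mono) auto
  finally have "?E \<le> w 0 * q K + real m * 4 + w 0 * (\<rho> - 1) * (q (Suc \<kappa>) - q \<kappa>)"
    by (simp add: algebra_simps)
  \<comment> \<open>The hypothesis \<open>large\<close> absorbs all slacks into one further
    \<open>w 0\<close>.\<close>
  also have "\<dots> \<le> w 0 * 1 + w 0 + w 0 * (\<rho> - 1) * (q (Suc \<kappa>) - q \<kappa>)"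
    using w0 q01 large by (intro add_mono mult_left_mono order_refl) auto
  \<comment> \<open>Replacing the factor \<open>\<rho> - 1\<close> by \<open>\<rho>\<close> costs
    the third \<open>w 0\<close>, since the increment is at least -1.\<close>
  also have "\<dots> \<le> w 0 * (3 + \<rho> * (q (Suc \<kappa>) - q \<kappa>))"
  proof -
    have "w 0 * (-1) \<le> w 0 * (q (Suc \<kappa>) - q \<kappa>)"
      using w0 q01[of \<kappa>] q01[of "Suc \<kappa>"] by (intro mult_left_mono) linarith+
    then show ?thesis by (simp add: algebra_simps)
  qed
  finally show ?thesis using \<rho> w0 by (simp add: field_simps)
qed

end

section \<open>Queries\<close>

fun query_pair :: "query \<Rightarrow> nat \<times> nat" where
  "query_pair (ValQ i j z) = (i, j)"
| "query_pair (QuantQ i j p) = (i, j)"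

abbreviation base_inst :: "nat \<Rightarrow> nat \<Rightarrow> (nat \<Rightarrow> real) \<Rightarrow> nat \<Rightarrow> (nat \<Rightarrow> real) \<Rightarrow> nat \<Rightarrow> nat \<Rightarrow> real measure" where
  "base_inst i j x K w \<equiv> inst i j (map_pmf x (tail_pmf (equal_revenue_tail K w)))"

abbreviation bump_inst ::
    "nat \<Rightarrow> nat \<Rightarrow> (nat \<Rightarrow> real) \<Rightarrow> nat \<Rightarrow> (nat \<Rightarrow> real) \<Rightarrow> nat \<Rightarrow> nat \<Rightarrow> nat \<Rightarrow> real measure" where
  "bump_inst i j x K w \<kappa> \<equiv> inst i j (map_pmf x (tail_pmf (bumped_tail K w \<kappa>)))"

lemma sum_query_count_le:
  "(\<Sum>i<n. \<Sum>j<m. length (filter (\<lambda>q. query_pair q = (i, j)) qs)) \<le> length qs"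
proof (induction qs)
  case (Cons q qs)
  obtain k l where q: "query_pair q = (k, l)" by (cases "query_pair q")
  have "(\<Sum>j<m. if query_pair q = (i, j) then 1 else 0 :: nat) \<le> (if i = k then 1 else 0)" for i
    by (auto simp: q sum.delta')
  then have "(\<Sum>i<n. \<Sum>j<m. if query_pair q = (i, j) then 1 else 0 :: nat) \<le> (\<Sum>i<n. if i = k then 1 else 0)"
    by (rule sum_mono)
  also have "\<dots> \<le> 1" by simp
  finally have "(\<Sum>i<n. \<Sum>j<m. if query_pair q = (i, j) then 1 else 0 :: nat) \<le> 1" .
  moreover have "length (filter (\<lambda>q. query_pair q = p) (q # qs)) =
      (if query_pair q = p then 1 else 0) + length (filter (\<lambda>q. query_pair q = p) qs)" for p
    by simp
  ultimately show ?case using Cons.IH by (simp only: sum.distrib list.size)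
qed simp

text \<open>The scale \<open>x\<close> runs through all naturals and is unbounded, so that
  \<open>level\<close> is meaningful for every queried value; indices beyond \<open>K\<close> carry
  no mass.\<close>

locale scaled_doubling = doubling +
  fixes x :: "nat \<Rightarrow> real"
  assumes x_strict: "strict_mono x" and x_unbounded: "\<exists>k. z \<le> x k" and x_ge: "1 \<le> x k"
begin

lemma x_nonneg: "0 \<le> x k" using x_ge[of k] by simp

lemma prob_bump:
  "\<kappa> < K \<Longrightarrow> measure_pmf.prob (map_pmf x (tail_pmf (bumped_tail K w \<kappa>))) {z..} = bumped_tail K w \<kappa> (level x z)"
  by (rule tail_fun.prob_scaled_tail[OF bumped_tail_fun strict_mono_mono[OF x_strict] x_unbounded])

lemma measure_bump_inst:
  "\<kappa> < K \<Longrightarrow> measure (bump_inst i j x K w \<kappa> i j) {z..} = bumped_tail K w \<kappa> (level x z)"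
  using prob_bump[of \<kappa> z] by (simp add: measure_inst)

lemma measure_base_inst:
  "measure (base_inst i j x K w i j) {z..} = equal_revenue_tail K w (level x z)"
  using prob_scaled_tail[OF strict_mono_mono[OF x_strict] x_unbounded, of z]
  by (simp add: measure_inst)

lemma antimono_tail: "k \<le> l \<Longrightarrow> equal_revenue_tail K w l \<le> equal_revenue_tail K w k"
  using lift_Suc_antimono_le[of "equal_revenue_tail K w"] decr by blast

text \<open>A value query reads the tail at one index and notices only the bump that changes this
  index. A quantile query \<open>p\<close> notices only a bump with \<open>p\<close> between the
  tails at \<open>Suc \<kappa>\<close> (excluded) and \<open>\<kappa>\<close> (included), and these
  intervals are disjoint.\<close>

lemma card_detecting_le:
  "card {\<kappa>\<in>{..<K}. answer n m (bump_inst i j x K w \<kappa>) q \<noteq> answer n m (base_inst i j x K w) q}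
     \<le> (if query_pair q = (i, j) then 1 else 0)" (is "card ?D \<le> _")
proof (cases "query_pair q = (i, j)")
  case False
  then have "?D = {}" by (cases q) (auto simp: answer_def inst_def)
  then show ?thesis using False by (simp only: card.empty)
next
  case True
  have "\<kappa> = \<kappa>'" if "\<kappa> \<in> ?D" "\<kappa>' \<in> ?D" for \<kappa> \<kappa>'
  proof (cases q)
    case (ValQ k l z)
    have *: "level x z = Suc \<kappa>" if "\<kappa> \<in> ?D" for \<kappa>
    proof -
      have "bumped_tail K w \<kappa> (level x z) \<noteq> equal_revenue_tail K w (level x z)"
        using that True ValQ
        by (auto simp: answer_def measure_base_inst measure_bump_inst split: if_splits)
      then show ?thesis by (auto simp: bumped_tail_def split: if_splits)
    qed
    show ?thesis using *[OF that(1)] *[OF that(2)] by simp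
  next
    case (QuantQ k l p)
    have *: "equal_revenue_tail K w (Suc \<kappa>) < p \<and> p \<le> equal_revenue_tail K w \<kappa>" if "\<kappa> \<in> ?D" for \<kappa>
    proof (rule ccontr)
      assume "\<not> (equal_revenue_tail K w (Suc \<kappa>) < p \<and> p \<le> equal_revenue_tail K w \<kappa>)"
      \<comment> \<open>The sets under the supremum coincide, which settles also
        \<open>p \<le> 0\<close>, where they are unbounded.\<close>
      then have "p \<le> bumped_tail K w \<kappa> k \<longleftrightarrow> p \<le> equal_revenue_tail K w k" for k
        using decr[of \<kappa>] by (auto simp: bumped_tail_def)
      then show False
        using that True QuantQ by (auto simp: answer_def measure_base_inst measure_bump_inst split: if_splits)
    qed
    have less: "\<not> \<kappa> < \<kappa>'" if "\<kappa> \<in> ?D" "\<kappa>' \<in> ?D" for \<kappa> \<kappa>'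
    proof
      assume "\<kappa> < \<kappa>'"
      then show False
        using *[OF that(1)] *[OF that(2)] antimono_tail[of "Suc \<kappa>" \<kappa>'] by linarith
    qed
    show ?thesis using less[OF that] less[OF that(2,1)] by linarith
  qed
  then have "card ?D \<le> Suc 0" by (subst card_le_Suc0_iff_eq) auto
  then show ?thesis using True by simp
qed

lemma card_detected_le:
  "card {\<kappa>\<in>{..<K}. map (answer n m (bump_inst i j x K w \<kappa>)) qs \<noteq> map (answer n m (base_inst i j x K w)) qs}
     \<le> length (filter (\<lambda>q. query_pair q = (i, j)) qs)"
proof (induction qs)
  case (Cons q qs)
  let ?a = "\<lambda>\<kappa>. answer n m (bump_inst i j x K w \<kappa>)" and ?b = "answer n m (base_inst i j x K w)"
  have "card {\<kappa>\<in>{..<K}. map (?a \<kappa>) (q # qs) \<noteq> map ?b (q # qs)}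
      \<le> card ({\<kappa>\<in>{..<K}. ?a \<kappa> q \<noteq> ?b q} \<union> {\<kappa>\<in>{..<K}. map (?a \<kappa>) qs \<noteq> map ?b qs})"
    by (intro card_mono) auto
  also have "\<dots> \<le> card {\<kappa>\<in>{..<K}. ?a \<kappa> q \<noteq> ?b q} + card {\<kappa>\<in>{..<K}. map (?a \<kappa>) qs \<noteq> map ?b qs}"
    by (rule card_Un_le)
  also have "\<dots> \<le> (if query_pair q = (i, j) then 1 else 0) + length (filter (\<lambda>q. query_pair q = (i, j)) qs)"
    by (rule add_mono[OF card_detecting_le Cons.IH])
  also have "\<dots> = length (filter (\<lambda>q. query_pair q = (i, j)) (q # qs))" by simp
  finally show ?case .
qed simp

lemma set_scaled_subset: "\<kappa> < K \<Longrightarrow> set_pmf (map_pmf x (tail_pmf (bumped_tail K w \<kappa>))) \<subseteq> x ` {..K}"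
  using tail_fun.set_tail_pmf[OF bumped_tail_fun] by auto

lemma valid_bump_inst:
  assumes "\<kappa> < K" "x K \<le> H"
  shows "valid_instance n m H (bump_inst i j x K w \<kappa>)"
proof (rule valid_inst)
  have "x k \<le> H" if "k \<le> K" for k
    using that assms(2) strict_mono_less_eq[OF x_strict, of k K] by simp
  then show "set_pmf (map_pmf x (tail_pmf (bumped_tail K w \<kappa>))) \<subseteq> {1..H}"
    using set_scaled_subset[OF assms(1)] x_ge by fastforce
  show "1 \<le> H" using x_ge[of K] assms(2) by simp
qed

end

locale hard_family = scaled_doubling +
  fixes n m i j :: nat and v :: valuation
  assumes v: "succinct_subadditive n m v" and i: "i < n" and j: "j < m"
    and w: "\<And>k. w k = marg m v i j (x k)" and large: "4 * real m \<le> w 0"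
begin

text \<open>Price \<open>w (Suc \<kappa>)\<close> with threshold \<open>x (Suc \<kappa>)\<close>
  sells with the raised probability \<open>w 0 / w \<kappa>\<close>. Monotonicity of
  \<open>w\<close> up to \<open>K\<close> makes accepting above and refusing below the threshold
  optimal.\<close>

lemma OPT_bump_ge:
  assumes \<kappa>: "\<kappa> < K"
  shows "w 0 * (w (Suc \<kappa>) / w \<kappa>) \<le> OPT n m v (bump_inst i j x K w \<kappa>)"
proof -
  let ?P = "map_pmf x (tail_pmf (bumped_tail K w \<kappa>))"
  note sub = set_scaled_subset[OF \<kappa>]
  have wx: "w k \<le> x k" for k
    using marg_le[OF v i j x_nonneg] by (simp add: w)
  have "w (Suc \<kappa>) * measure_pmf.prob ?P {x (Suc \<kappa>)..} \<le> OPT n m v (inst i j ?P)"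
  proof (rule OPT_ge_posted[OF v i j])
    show "finite (set_pmf ?P)" using sub finite_subset by blast
    show "set_pmf ?P \<subseteq> {0..}" using sub x_nonneg by auto
    show "w (Suc \<kappa>) \<le> y" if "y \<in> set_pmf ?P" "x (Suc \<kappa>) \<le> y" for y
      using that sub wx[of "Suc \<kappa>"] by simp
    show "w (Suc \<kappa>) \<le> marg m v i j y" if "y \<in> set_pmf ?P" "x (Suc \<kappa>) \<le> y" for y
      using that sub w_mono[of "Suc \<kappa>"] strict_mono_less_eq[OF x_strict] by (auto simp flip: w)
    show "marg m v i j y \<le> w (Suc \<kappa>)" if "y \<in> set_pmf ?P" "y < x (Suc \<kappa>)" for y
      using that sub w_mono[of _ "Suc \<kappa>"] strict_mono_less[OF x_strict] \<kappa> by (auto simp flip: w)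
  qed
  moreover have "level x (x (Suc \<kappa>)) = Suc \<kappa>"
    unfolding level_def by (rule Least_equality) (auto simp: strict_mono_less_eq[OF x_strict])
  then have "measure_pmf.prob ?P {x (Suc \<kappa>)..} = w 0 / w \<kappa>"
    using \<kappa> unfolding prob_bump[OF \<kappa>] by (simp add: bumped_tail_def equal_revenue_tail_def)
  ultimately show ?thesis by (simp add: mult.commute)
qed

text \<open>For non-measurable payments the revenue is 0 and the first summand alone
  suffices.\<close>

lemma Rev_bump_le:
  assumes M: "DSIC n m v M" and \<kappa>: "\<kappa> < K"
  defines "q \<equiv> \<lambda>k. win_prob n m M i j (x k)"
  shows "Rev n m (bump_inst i j x K w \<kappa>) M / (w 0 * (w (Suc \<kappa>) / w \<kappa>)) \<le>
    3 * (w \<kappa> / w (Suc \<kappa>)) +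
    (if (\<lambda>b. \<Sum>k<n. snd M b k) \<in> borel_measurable (profiles n m) then q (Suc \<kappa>) - q \<kappa> else 0)"
  using bumped_DSIC_expected_payment_le[OF v M i j x_nonneg w \<kappa> large] w_pos[of \<kappa>] w_pos[of "Suc \<kappa>"] \<kappa>
  by (auto simp: Rev_inst[OF i j] q_def)

text \<open>On undetected bumps the same mechanism is run, so its winning probabilities telescope over
  the scales; each detected bump costs at most two.\<close>
lemma sum_Rev_bump_le:
  assumes M: "\<And>as. DSIC n m v (M as)" and \<epsilon>: "\<And>\<kappa>. \<kappa> < K \<Longrightarrow> w \<kappa> / w (Suc \<kappa>) \<le> \<epsilon>"
  shows "(\<Sum>\<kappa><K. Rev n m (bump_inst i j x K w \<kappa>) (M (map (answer n m (bump_inst i j x K w \<kappa>)) qs))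
             / (w 0 * (w (Suc \<kappa>) / w \<kappa>)))
    \<le> 3 * \<epsilon> * real K + 1 + 2 * real (length (filter (\<lambda>q. query_pair q = (i, j)) qs))"
proof -
  let ?B = "bump_inst i j x K w"
  let ?R = "\<lambda>\<kappa>. Rev n m (?B \<kappa>) (M (map (answer n m (?B \<kappa>)) qs)) / (w 0 * (w (Suc \<kappa>) / w \<kappa>))"
  define M0 where "M0 = M (map (answer n m (base_inst i j x K w)) qs)"
  define D where "D = {\<kappa>\<in>{..<K}. map (answer n m (?B \<kappa>)) qs \<noteq> map (answer n m (base_inst i j x K w)) qs}"
  define q where "q k = win_prob n m M0 i j (x k)" for k
  \<comment> \<open>The measurability condition is the same for all \<open>\<kappa>\<close>: either
    all increments telescope or all are 0.\<close>
  define \<delta> where "\<delta> \<kappa> = (if (\<lambda>b. \<Sum>k<n. snd M0 b k) \<in> borel_measurable (profiles n m)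
      then q (Suc \<kappa>) - q \<kappa> else 0)" for \<kappa>
  have wp: "\<bar>win_prob n m N i j y - win_prob n m N i j z\<bar> \<le> 1" for N y z
    using win_prob_bounds[of n m N i j y] win_prob_bounds[of n m N i j z] by linarith
  have \<delta>: "\<bar>\<delta> \<kappa>\<bar> \<le> 1" for \<kappa>
    using wp by (simp add: \<delta>_def q_def)
  have "?R \<kappa> \<le> 3 * \<epsilon> + \<delta> \<kappa> + 2 * indicator D \<kappa>" if \<kappa>: "\<kappa> < K" for \<kappa>
  proof (cases "\<kappa> \<in> D")
    case False
    then have "map (answer n m (?B \<kappa>)) qs = map (answer n m (base_inst i j x K w)) qs"
      using \<kappa> by (auto simp: D_def)
    then have "M (map (answer n m (?B \<kappa>)) qs) = M0" by (simp only: M0_def)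
    moreover have "DSIC n m v M0" by (simp only: M0_def M)
    ultimately have "?R \<kappa> \<le> 3 * (w \<kappa> / w (Suc \<kappa>)) + \<delta> \<kappa>"
      using Rev_bump_le[of M0 \<kappa>] \<kappa> unfolding \<delta>_def q_def by simp
    then show ?thesis using \<epsilon>[OF \<kappa>] False by simp
  next
    case True
    \<comment> \<open>One unit bounds the increment of the mechanism actually run, a second one
      makes up for \<open>\<delta> \<kappa>\<close>, which may be as low as -1.\<close>
    have "?R \<kappa> \<le> 3 * (w \<kappa> / w (Suc \<kappa>)) + 1"
      using Rev_bump_le[OF M \<kappa>, of "map (answer n m (?B \<kappa>)) qs"]
        wp[of "M (map (answer n m (?B \<kappa>)) qs)" "x (Suc \<kappa>)" "x \<kappa>"] by (auto split: if_splits)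
    then show ?thesis using \<epsilon>[OF \<kappa>] \<delta>[of \<kappa>] True by simp
  qed
  then have "(\<Sum>\<kappa><K. ?R \<kappa>) \<le> (\<Sum>\<kappa><K. 3 * \<epsilon> + \<delta> \<kappa> + 2 * indicator D \<kappa>)"
    by (intro sum_mono) auto
  also have "\<dots> = 3 * \<epsilon> * real K + (\<Sum>\<kappa><K. \<delta> \<kappa>) + 2 * real (card D)"
  proof -
    have "(\<Sum>\<kappa><K. indicator D \<kappa> :: real) = real (card D)"
      using sum.inter_restrict[of "{..<K}" "\<lambda>_. 1 :: real" D]
      by (simp add: indicator_def D_def Int_def conj_ac)
    then show ?thesis by (simp add: sum.distrib flip: sum_distrib_left)
  qed
  also have "(\<Sum>\<kappa><K. \<delta> \<kappa>) \<le> 1"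
    using wp[of M0 "x K" "x 0"] sum_lessThan_telescope[of q K]
    by (cases "(\<lambda>b. \<Sum>k<n. snd M0 b k) \<in> borel_measurable (profiles n m)") (simp_all add: \<delta>_def q_def)
  also have "card D \<le> length (filter (\<lambda>q. query_pair q = (i, j)) qs)"
    unfolding D_def by (rule card_detected_le)
  finally show ?thesis by simp
qed

end

section \<open>The lower bound\<close>

text \<open>A non-integrable function has integral 0 by convention, which \<open>0 \<le> C\<close>
  covers.\<close>

lemma (in prob_space) integral_le_nonneg_bound:
  fixes f :: "'a \<Rightarrow> real"
  assumes "\<And>x. f x \<le> C" and "0 \<le> C"
  shows "(\<integral>x. f x \<partial>M) \<le> C"
proof (cases "integrable M f")
  case True
  then show ?thesis using assms(1) by (intro integral_le_const) auto
qed (use assms(2) in \<open>simp add: not_integrable_integral_eq\<close>)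

text \<open>The positive part dominates. The nonnegative integral on the right is monotone without
  measurability and can thus be compared with \<open>expected_queries\<close>.\<close>

lemma ennreal_integral_le_nn_integral:
  fixes f :: "'a \<Rightarrow> real"
  assumes "integrable M f"
  shows "ennreal (\<integral>x. f x \<partial>M) \<le> (\<integral>\<^sup>+ x. ennreal (f x) \<partial>M)"
proof -
  have int: "integrable M (\<lambda>x. max 0 (f x))" using assms by simp
  have "ennreal (\<integral>x. f x \<partial>M) \<le> ennreal (\<integral>x. max 0 (f x) \<partial>M)"
    by (intro ennreal_leI integral_mono assms int) auto
  also have "\<dots> = (\<integral>\<^sup>+ x. ennreal (max 0 (f x)) \<partial>M)"
    by (rule nn_integral_eq_integral[symmetric, OF int]) auto
  also have "\<dots> = (\<integral>\<^sup>+ x. ennreal (f x) \<partial>M)"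
    by (intro nn_integral_cong) (auto simp: max_def ennreal_neg)
  finally show ?thesis .
qed

text \<open>If the item is worth little more than the empty bundle, a DSIC mechanism cannot charge for it,
  whereas with a known value the outside option can be taxed away.\<close>
lemma point_mass_instance:
  assumes c: "1 < c" and v: "succinct_subadditive n m v" and i: "i < n" and j: "j < m"
    and Q: "query_DSIC n m v R qs QM"
    and x: "8 * c * real m \<le> x" "x \<le> H" and small: "marg m v i j x < x / (2 * c)"
  shows "\<exists>D. valid_instance n m H D \<and> QRev n m D R qs QM < OPT n m v D / c"
proof (intro exI conjI)
  let ?P = "return_pmf x"
  interpret R: prob_space R using Q by (simp add: query_DSIC_def)
  have "1 * 1 \<le> c * real m" using c j by (intro mult_mono) auto
  then have x1: "1 \<le> x" using x by simp
  then have x0: "0 \<le> x" by simp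
  show "valid_instance n m H (inst i j ?P)"
    using x1 x by (intro valid_inst) auto
  \<comment> \<open>With \<open>x\<close> as threshold and price, no type lies below the threshold,
    so only individual rationality is left to check.\<close>
  have "x * measure_pmf.prob ?P {x..} \<le> OPT n m v (inst i j ?P)"
    using x1 by (intro OPT_ge_posted[OF v i j]) auto
  then have opt: "x \<le> OPT n m v (inst i j ?P)" by simp
  have "Rev n m (inst i j ?P) M \<le> x / (2 * c) + 2 * real m" if M: "DSIC n m v M" for M
  proof -
    have "marg m v i j x * win_prob n m M i j x \<le> marg m v i j x * 1"
      by (intro mult_left_mono win_prob_bounds marg_nonneg[OF v i j x0])
    then have "(\<Sum>k<n. snd M (prof n m i j x) k) \<le> x / (2 * c) + 2 * real m"
      using total_payment_le[OF v i j M x0] payment_le[OF v i j M x0] small by simp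
    then show ?thesis using x0 c by (auto simp: Rev_inst[OF i j])
  qed
  then have "QRev n m (inst i j ?P) R qs QM \<le> x / (2 * c) + 2 * real m"
    unfolding QRev_def using Q x0 c by (intro R.integral_le_nonneg_bound) (auto simp: query_DSIC_def)
  \<comment> \<open>From \<open>8 * c * real m \<le> x\<close> the summand \<open>2 * real m\<close>
    is at most \<open>x / (4 * c)\<close>.\<close>
  also have "\<dots> < x / c"
    using x c x1 j by (simp add: field_simps)
  also have "\<dots> \<le> OPT n m v (inst i j ?P) / c"
    using opt c by (simp add: divide_right_mono)
  finally show "QRev n m (inst i j ?P) R qs QM < OPT n m v (inst i j ?P) / c" .
qed

text \<open>If no instance were bad, every bump would earn at least the fraction
  \<open>1 / c\<close> of its benchmark, so the sum over all triples would be at least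
  \<open>n * m * K / c\<close> on average. For fixed coins that sum is at most half of this plus
  twice the number of queries.\<close>

lemma hard_instance:
  assumes c: "1 < c" and n: "1 \<le> n" and m: "1 \<le> m" and v: "succinct_subadditive n m v"
    and Q: "query_DSIC n m v R qs QM"
    and K: "4 * c \<le> real K" and H: "8 * c * real m * (24 * c\<^sup>2) ^ K \<le> H"
    and few: "expected_queries R qs < ennreal (real n * real m * real K / (4 * c))"
  shows "\<exists>D. valid_instance n m H D \<and> QRev n m D R qs QM < OPT n m v D / c"
proof -
  interpret R: prob_space R using Q by (simp add: query_DSIC_def)
  \<comment> \<open>Outside the point-mass case \<open>w\<close> lies between
    \<open>x / (2 * c)\<close> and \<open>x\<close>. The ratio \<open>24 * c\<^sup>2\<close> thus
    makes \<open>w\<close> grow by at least \<open>12 * c\<close> per step, and the start gives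
    \<open>w 0 \<ge> 4 * m\<close>.\<close>
  define x where "x k = 8 * c * real m * (24 * c\<^sup>2) ^ k" for k :: nat
  define w where "w i j k = marg m v i j (x k)" for i j k
  have "1 * 1 \<le> c * real m" using c m by (intro mult_mono) auto
  then have x0: "8 \<le> x 0" by (simp add: x_def)
  have c2: "1 < c\<^sup>2" using c by (simp add: one_less_power)
  have xS: "x (Suc k) = 24 * c\<^sup>2 * x k" for k by (simp add: x_def)
  have x_pos: "0 < x k" for k using c m by (simp add: x_def)
  have x_strict: "strict_mono x"
  proof (rule strict_monoI_Suc)
    show "x k < x (Suc k)" for k
      unfolding xS using mult_strict_right_mono[of 1 "24 * c\<^sup>2" "x k"] x_pos[of k] c2 by simp
  qed
  have x_ge0: "x 0 \<le> x k" for k using strict_mono_less_eq[OF x_strict, of 0 k] by simp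
  have x_unb: "\<exists>k. z \<le> x k" for z
  proof -
    obtain k where k: "z < (24 * c\<^sup>2) ^ k" using real_arch_pow[of "24 * c\<^sup>2" z] c2 by auto
    have "(24 * c\<^sup>2) ^ k * 1 \<le> (24 * c\<^sup>2) ^ k * x 0" using x0 by (intro mult_left_mono) auto
    then show ?thesis using k by (intro exI[of _ k]) (auto simp: x_def mult_ac)
  qed
  have xK: "x k \<le> H" if "k \<le> K" for k
    using strict_mono_less_eq[OF x_strict, of k K] that H by (simp add: x_def)
  show ?thesis
  proof (cases "\<exists>i<n. \<exists>j<m. \<exists>k\<le>K. marg m v i j (x k) < x k / (2 * c)")
    case True
    then obtain i j k where "i < n" "j < m" "k \<le> K" "marg m v i j (x k) < x k / (2 * c)" by blast
    then show ?thesis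
      using x_ge0[of k] xK[of k] by (intro point_mass_instance[OF c v _ _ Q, of i j "x k"]) (auto simp: x_def)
  next
    case False
    have w_ge: "x k / (2 * c) \<le> w i j k" if "i < n" "j < m" "k \<le> K" for i j k
    proof -
      have "\<not> marg m v i j (x k) < x k / (2 * c)" using False that by blast
      then show ?thesis by (simp add: w_def)
    qed
    have w_le: "w i j k \<le> x k" if "i < n" "j < m" for i j k
      unfolding w_def using x_pos[of k] by (intro marg_le[OF v that]) auto
    have ratio: "12 * c * w i j k \<le> w i j (Suc k)" if "i < n" "j < m" "k < K" for i j k
    proof -
      have "12 * c * w i j k \<le> 12 * c * x k" using w_le[OF that(1,2)] c by (intro mult_left_mono) auto
      also have "\<dots> = x (Suc k) / (2 * c)" using c by (simp add: xS power2_eq_square)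
      also have "\<dots> \<le> w i j (Suc k)" using that by (intro w_ge) auto
      finally show ?thesis .
    qed
    have w0: "4 * real m \<le> w i j 0" if "i < n" "j < m" for i j
      using w_ge[OF that, of 0] c by (simp add: x_def)
    have fam: "hard_family (w i j) K x n m i j v" if "i < n" "j < m" for i j
    proof
      show "0 < w i j 0" using w0[OF that] m by simp
      then have w_pos: "0 < w i j k" if "k \<le> K" for k
        using w_ge[OF \<open>i < n\<close> \<open>j < m\<close> that] x_pos[of k] c
        by (smt (verit) divide_pos_pos mult_pos_pos)
      show "2 * w i j k \<le> w i j (Suc k)" if "k < K" for k
      proof -
        have "2 * w i j k \<le> 12 * c * w i j k"
          using w_pos[of k] that c by (intro mult_right_mono) auto
        then show ?thesis using ratio[OF \<open>i < n\<close> \<open>j < m\<close> that] by simp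
      qed
      show "1 \<le> x k" for k using x_ge0[of k] x0 by simp
    qed (use that v x_strict x_unb w0 in \<open>auto simp: w_def\<close>)
    let ?D = "\<lambda>i j \<kappa>. bump_inst i j x K (w i j) \<kappa>"
    define L where "L i j \<kappa> = w i j 0 * (w i j (Suc \<kappa>) / w i j \<kappa>)" for i j \<kappa>
    define f where "f i j \<kappa> r = Rev n m (?D i j \<kappa>) (QM r (map (answer n m (?D i j \<kappa>)) (qs r)))" for i j \<kappa> r
    define G where "G r = (\<Sum>i<n. \<Sum>j<m. \<Sum>\<kappa><K. f i j \<kappa> r / L i j \<kappa>)" for r
    show ?thesis
    proof (rule ccontr)
      assume contra: "\<not> ?thesis"
      have L_pos: "0 < L i j \<kappa>" if "i < n" "j < m" "\<kappa> < K" for i j \<kappa>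
      proof -
        interpret hard_family "w i j" K x n m i j v by (rule fam[OF that(1,2)])
        show ?thesis using w_pos[of \<kappa>] w_pos[of "Suc \<kappa>"] w_pos[of 0] that(3) by (simp add: L_def)
      qed
      have Q_ge: "L i j \<kappa> / c \<le> (\<integral>r. f i j \<kappa> r \<partial>R)" if "i < n" "j < m" "\<kappa> < K" for i j \<kappa>
      proof -
        interpret hard_family "w i j" K x n m i j v by (rule fam[OF that(1,2)])
        have "OPT n m v (?D i j \<kappa>) / c \<le> QRev n m (?D i j \<kappa>) R qs QM"
          using contra valid_bump_inst[OF that(3) xK[OF order_refl], of n m i j] by (auto simp: not_less)
        moreover have "L i j \<kappa> / c \<le> OPT n m v (?D i j \<kappa>) / c"
          unfolding L_def using OPT_bump_ge[OF that(3)] c by (intro divide_right_mono) auto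
        ultimately show ?thesis by (simp add: QRev_def f_def)
      qed
      \<comment> \<open>Otherwise the integral would be 0 by convention, against its positive lower
        bound.\<close>
      have f_int: "integrable R (f i j \<kappa>)" if "i < n" "j < m" "\<kappa> < K" for i j \<kappa>
      proof (rule ccontr)
        assume "\<not> integrable R (f i j \<kappa>)"
        moreover have "0 < L i j \<kappa> / c" using L_pos[OF that] c by simp
        ultimately show False using Q_ge[OF that] by (simp add: not_integrable_integral_eq)
      qed
      have G_int: "integrable R G"
        unfolding G_def using f_int by (intro Bochner_Integration.integrable_sum) auto
      have "(\<integral>r. G r \<partial>R) = (\<Sum>i<n. \<integral>r. (\<Sum>j<m. \<Sum>\<kappa><K. f i j \<kappa> r / L i j \<kappa>) \<partial>R)"
        unfolding G_def using f_int
        by (intro Bochner_Integration.integral_sum Bochner_Integration.integrable_sum) auto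
      also have "\<dots> = (\<Sum>i<n. \<Sum>j<m. \<integral>r. (\<Sum>\<kappa><K. f i j \<kappa> r / L i j \<kappa>) \<partial>R)"
        using f_int
        by (intro sum.cong refl Bochner_Integration.integral_sum Bochner_Integration.integrable_sum) auto
      also have "\<dots> = (\<Sum>i<n. \<Sum>j<m. \<Sum>\<kappa><K. \<integral>r. f i j \<kappa> r / L i j \<kappa> \<partial>R)"
        using f_int by (intro sum.cong refl Bochner_Integration.integral_sum) auto
      also have "\<dots> = (\<Sum>i<n. \<Sum>j<m. \<Sum>\<kappa><K. (\<integral>r. f i j \<kappa> r \<partial>R) / L i j \<kappa>)"
        by simp
      also have "\<dots> \<ge> (\<Sum>i<n. \<Sum>j<m. \<Sum>\<kappa><K. 1 / c)"
        using Q_ge L_pos by (intro sum_mono) (simp add: pos_le_divide_eq mult.commute)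
      finally have G_ge: "real n * real m * real K / c \<le> (\<integral>r. G r \<partial>R)" by simp
      have G_le: "G r \<le> real n * real m * real K / (2 * c) + 2 * real (length (qs r))" for r
      proof -
        let ?N = "\<lambda>i j. length (filter (\<lambda>q. query_pair q = (i, j)) (qs r))"
        have "(\<Sum>\<kappa><K. f i j \<kappa> r / L i j \<kappa>) \<le> real K / (2 * c) + 2 * real (?N i j)"
          if "i < n" "j < m" for i j
        proof -
          interpret hard_family "w i j" K x n m i j v by (rule fam[OF that])
          have "w i j \<kappa> / w i j (Suc \<kappa>) \<le> 1 / (12 * c)" if "\<kappa> < K" for \<kappa>
            using ratio[OF i j that] w_pos[of "Suc \<kappa>"] that c by (simp add: field_simps)
          then have "(\<Sum>\<kappa><K. f i j \<kappa> r / L i j \<kappa>) \<le> 3 * (1 / (12 * c)) * real K + 1 + 2 * real (?N i j)"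
            unfolding f_def L_def using Q by (intro sum_Rev_bump_le) (auto simp: query_DSIC_def)
          \<comment> \<open>The ratio contributes \<open>K / (4 * c)\<close> and the telescoped 1 at
            most as much again, together \<open>K / (2 * c)\<close>.\<close>
          moreover have "1 \<le> real K / (4 * c)" using K c by (simp add: field_simps)
          ultimately show ?thesis using c by (simp add: field_simps)
        qed
        then have "G r \<le> (\<Sum>i<n. \<Sum>j<m. real K / (2 * c) + 2 * real (?N i j))"
          unfolding G_def by (intro sum_mono) auto
        also have "\<dots> = real n * real m * real K / (2 * c) + 2 * real (\<Sum>i<n. \<Sum>j<m. ?N i j)"
          by (simp add: sum.distrib sum_distrib_left)
        also have "\<dots> \<le> real n * real m * real K / (2 * c) + 2 * real (length (qs r))"
          by (intro add_left_mono mult_left_mono of_nat_mono sum_query_count_le) auto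
        finally show ?thesis .
      qed
      \<comment> \<open>Solving \<open>G_le\<close> for the number of queries gives an integrable
        lower bound on the possibly non-measurable length.\<close>
      define h where "h r = (G r - real n * real m * real K / (2 * c)) / 2" for r
      have h_int: "integrable R h" unfolding h_def using G_int by simp
      have "real n * real m * real K / (4 * c) \<le> (\<integral>r. h r \<partial>R)"
        using G_ge G_int c by (simp add: h_def R.prob_space field_simps)
      then have "ennreal (real n * real m * real K / (4 * c)) \<le> ennreal (\<integral>r. h r \<partial>R)"
        by (rule ennreal_leI)
      also have "\<dots> \<le> (\<integral>\<^sup>+ r. ennreal (h r) \<partial>R)" by (rule ennreal_integral_le_nn_integral[OF h_int])
      also have "\<dots> \<le> expected_queries R qs"
        unfolding expected_queries_def
      proof (intro nn_integral_mono ennreal_leI)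
        show "h r \<le> real (length (qs r))" for r using G_le[of r] by (simp add: h_def)
      qed
      finally show False using few by simp
    qed
  qed
qed

theorem theorem2:
  "\<forall>c::real. c > 1 \<longrightarrow> (\<exists>C::real. C > 0 \<and>
     (\<forall>m::nat. m \<ge> 1 \<longrightarrow> (\<exists>H0::real. \<forall>n::nat. \<forall>H::real. n \<ge> 1 \<longrightarrow> H \<ge> H0 \<longrightarrow>
        (\<forall>v::valuation. succinct_subadditive n m v \<longrightarrow>
          (\<forall>(R::real measure) qs QM.
             query_DSIC n m v R qs QM \<longrightarrow>
             expected_queries R qs < ennreal (C * real n * real m * log c H) \<longrightarrow>
             (\<exists>D. valid_instance n m H D \<and> QRev n m D R qs QM < OPT n m v D / c))))))"
proof (intro allI impI)
  fix c :: real
  assume c: "1 < c"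
  define A where "A = 24 * c\<^sup>2"
  have "1 < c\<^sup>2" using c by (simp add: one_less_power)
  then have A: "1 < A" by (simp add: A_def)
  have lA: "0 < log c A" using c A by simp
  \<comment> \<open>Chosen so that \<open>C * log c H\<close> is \<open>log A H / (8 * c)\<close>,
    at most \<open>K / (4 * c)\<close> once \<open>K\<close> is at least half of
    \<open>log A H\<close>.\<close>
  define C where "C = 1 / (8 * c * log c A)"
  have C: "0 < C" using c lA by (simp add: C_def)
  show "\<exists>C>0. \<forall>m::nat. m \<ge> 1 \<longrightarrow> (\<exists>H0::real. \<forall>n::nat. \<forall>H::real. n \<ge> 1 \<longrightarrow> H \<ge> H0 \<longrightarrow>
        (\<forall>v::valuation. succinct_subadditive n m v \<longrightarrow>
          (\<forall>(R::real measure) qs QM.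
             query_DSIC n m v R qs QM \<longrightarrow>
             expected_queries R qs < ennreal (C * real n * real m * log c H) \<longrightarrow>
             (\<exists>D. valid_instance n m H D \<and> QRev n m D R qs QM < OPT n m v D / c))))"
  proof (rule exI[of _ C], intro conjI C allI impI)
    fix m :: nat
    assume m: "1 \<le> m"
    define x0 where "x0 = 8 * c * real m"
    have x0: "0 < x0" using c m by (simp add: x0_def)
    \<comment> \<open>The first term ensures \<open>4 * c \<le> K\<close>; the second makes the loss
      from \<open>x0\<close> and from rounding at most half of \<open>log A H\<close>. Neither
      depends on \<open>n\<close>.\<close>
    define L where "L = max (8 * c) (2 * (log A x0 + 1))"
    show "\<exists>H0::real. \<forall>n::nat. \<forall>H::real. n \<ge> 1 \<longrightarrow> H \<ge> H0 \<longrightarrow>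
        (\<forall>v::valuation. succinct_subadditive n m v \<longrightarrow>
          (\<forall>(R::real measure) qs QM.
             query_DSIC n m v R qs QM \<longrightarrow>
             expected_queries R qs < ennreal (C * real n * real m * log c H) \<longrightarrow>
             (\<exists>D. valid_instance n m H D \<and> QRev n m D R qs QM < OPT n m v D / c)))"
    proof (rule exI[of _ "A powr L"], intro allI impI)
      fix n :: nat and H :: real and v R qs QM
      assume n: "1 \<le> n" and H: "A powr L \<le> H" and v: "succinct_subadditive n m v"
        and Q: "query_DSIC n m v R qs QM"
        and few: "expected_queries R qs < ennreal (C * real n * real m * log c H)"
      have "0 < A powr L" using A by simp
      then have H0: "0 < H" using H by linarith
      have LH: "L \<le> log A H" using H A H0 by (simp add: le_log_iff)
      \<comment> \<open>The largest number of steps for which the scale starting at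
        \<open>x0\<close> stays within \<open>H\<close>.\<close>
      define K where "K = nat \<lfloor>log A H - log A x0\<rfloor>"
      have d: "0 \<le> log A H - log A x0" "log A H / 2 \<le> log A H - log A x0 - 1"
        using LH c by (auto simp: L_def)
      have K_le: "real K \<le> log A H - log A x0" using d(1) by (simp add: K_def)
      have K_ge: "log A H / 2 \<le> real K" using d by (simp add: K_def) linarith
      show "\<exists>D. valid_instance n m H D \<and> QRev n m D R qs QM < OPT n m v D / c"
      proof (rule hard_instance[OF c n m v Q])
        show "4 * c \<le> real K" using K_ge LH by (simp add: L_def)
        have "A powr real K \<le> A powr (log A H - log A x0)" using K_le A by simp
        also have "\<dots> = H / x0" using A H0 x0 by (simp add: powr_diff)
        finally have "x0 * A ^ K \<le> H" using x0 A by (simp add: powr_realpow field_simps)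
        then show "8 * c * real m * (24 * c\<^sup>2) ^ K \<le> H" by (simp add: x0_def A_def)
        have "log c H = log A H * log c A"
          using A c H0 by (simp add: log_def)
        then have "C * log c H = log A H / 2 / (4 * c)" using lA by (simp add: C_def)
        also have "\<dots> \<le> real K / (4 * c)" using K_ge c by (intro divide_right_mono) auto
        finally have "real n * real m * (C * log c H) \<le> real n * real m * (real K / (4 * c))"
          by (intro mult_left_mono) auto
        then have "C * real n * real m * log c H \<le> real n * real m * real K / (4 * c)"
          by (simp add: mult_ac)
        then show "expected_queries R qs < ennreal (real n * real m * real K / (4 * c))"
          using few ennreal_leI less_le_trans by blast
      qed
    qed
  qed
qed

end
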